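(* For any integers $s\ge 1$, $t\ge 2$ and $n\ge k+1$ (with $k\ge 1$), $$ex(n,K^*_{s,t},\mathcal{L}_{n,k})=\max\Bigg\{\binom{k}{s+t}\binom{s+t}{t},\ \binom{\left\lfloor\frac{k-1}{2}\right\rfloor}{s}\binom{n-s}{t}+\left(n-\left\lceil\frac{k+1}{2}\right\rceil\right)\binom{\left\lfloor\frac{k-1}{2}\right\rfloor}{s-1}\binom{\left\lfloor\frac{k-1}{2}\right\rfloor-s+1}{t}+\left(\binom{\left\lceil\frac{k+1}{2}\right\rceil}{s}-\binom{\left\lfloor\frac{k-1}{2}\right\rfloor}{s}\right)\binom{\left\lceil\frac{k+1}{2}\right\rceil-s}{t}\Bigg\}.$$
   Context: All graphs are simple. For a family of graphs $\mathcal{F}$, a graph $G$ is $\mathcal{F}$-free if no subgraph of $G$ is isomorphic to a member of $\mathcal{F}$. For a graph $T$, $ex(n,T,\mathcal{F})$ denotes the maximum number of (not necessarily induced) copies of $T$ in an $\mathcal{F}$-free graph on $n$ vertices. A linear forest is a graph whose connected components are all paths or isolated vertices. $\mathcal{L}_{n,k}$ denotes the family of all linear forests on $n$ vertices with exactly $k$ edges. $K^*_{s,t}$ is the graph obtained from the complete bipartite graph $K_{s,t}$ by replacing the part of size $s$ with a clique on those $s$ vertices (i.e. adding all edges inside the part of size $s$). *)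

theory Defs
  imports Complex_Main
begin

text \<open>A simple graph is a pair of a finite vertex set and a set of two-element
  subsets of it.\<close>

type_synonym 'a graph = "'a set \<times> 'a set set"

abbreviation verts :: "'a graph \<Rightarrow> 'a set" where "verts G \<equiv> fst G"
abbreviation edges :: "'a graph \<Rightarrow> 'a set set" where "edges G \<equiv> snd G"

definition simple_graph :: "'a graph \<Rightarrow> bool" where
  "simple_graph G \<longleftrightarrow> finite (verts G) \<and> (\<forall>e \<in> edges G. e \<subseteq> verts G \<and> card e = 2)"

definition subgraph :: "'a graph \<Rightarrow> 'a graph \<Rightarrow> bool" where
  "subgraph H G \<longleftrightarrow> simple_graph H \<and> verts H \<subseteq> verts G \<and> edges H \<subseteq> edges G"

definition isomorphic :: "'a graph \<Rightarrow> 'b graph \<Rightarrow> bool" where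
  "isomorphic G H \<longleftrightarrow> (\<exists>f. bij_betw f (verts G) (verts H) \<and>
     (\<forall>u \<in> verts G. \<forall>v \<in> verts G. {u, v} \<in> edges G \<longleftrightarrow> {f u, f v} \<in> edges H))"

definition family_free :: "'b graph set \<Rightarrow> 'a graph \<Rightarrow> bool" where
  "family_free \<F> G \<longleftrightarrow> (\<forall>H. subgraph H G \<longrightarrow> \<not> (\<exists>F \<in> \<F>. isomorphic H F))"

definition copies :: "'b graph \<Rightarrow> 'a graph \<Rightarrow> 'a graph set" where
  "copies T G = {H. subgraph H G \<and> isomorphic H T}"

text \<open>Every finite graph is isomorphic to one whose vertices are natural numbers, so the
  maximum ranges over those. The maximum is over a finite set of numbers
  (lemma \<open>finite_copy_counts\<close>); it is nonempty as soon as some graph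
  on \<open>n\<close> vertices is free of the family.\<close>

definition ex :: "nat \<Rightarrow> 'a graph \<Rightarrow> 'b graph set \<Rightarrow> nat" where
  "ex n T \<F> = Max {card (copies T G) | G :: nat graph.
     simple_graph G \<and> card (verts G) = n \<and> family_free \<F> G}"

definition component :: "'a graph \<Rightarrow> 'a \<Rightarrow> 'a graph" where
  "component G v =
     (let C = {u \<in> verts G. (v, u) \<in> {(x, y). {x, y} \<in> edges G}\<^sup>*}
      in (C, {e \<in> edges G. e \<subseteq> C}))"

text \<open>A one-vertex list gives an isolated vertex.\<close>

definition is_path :: "'a graph \<Rightarrow> bool" where
  "is_path G \<longleftrightarrow> (\<exists>p. p \<noteq> [] \<and> distinct p \<and> verts G = set p \<and>
     edges G = {{p ! i, p ! Suc i} | i. Suc i < length p})"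

definition linear_forest :: "'a graph \<Rightarrow> bool" where
  "linear_forest G \<longleftrightarrow> simple_graph G \<and> (\<forall>v \<in> verts G. is_path (component G v))"

text \<open>Since freeness is invariant under isomorphism of the forbidden graphs, it suffices to
  take the linear forests on natural numbers.\<close>

definition linear_forests :: "nat \<Rightarrow> nat \<Rightarrow> nat graph set" where
  "linear_forests n k = {F. linear_forest F \<and> card (verts F) = n \<and> card (edges F) = k}"

text \<open>The part of size \<open>s\<close> (the clique) is \<open>{..<s}\<close>, the other part is \<open>{s..<s + t}\<close>.\<close>

definition K_star :: "nat \<Rightarrow> nat \<Rightarrow> nat graph" where
  "K_star s t = ({..<s + t},
     {{i, j} | i j. i < s \<and> s \<le> j \<and> j < s + t} \<union> {{i, j} | i j. i < s \<and> j < s \<and> i \<noteq> j})"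

lemma finite_copy_counts:
  "finite {card (copies T G) | G :: nat graph.
     simple_graph G \<and> card (verts G) = n \<and> family_free \<F> G}"
proof -
  have "card (copies T G) \<le> 2 ^ n * 2 ^ 2 ^ n"
    if "simple_graph G" "card (verts G) = n" for G :: "nat graph"
  proof -
    have fin: "finite (verts G)" and E: "edges G \<subseteq> Pow (verts G)"
      using that by (auto simp: simple_graph_def)
    have "copies T G \<subseteq> Pow (verts G) \<times> Pow (Pow (verts G))"
      using E unfolding copies_def subgraph_def by fastforce
    then have "card (copies T G) \<le> card (Pow (verts G) \<times> Pow (Pow (verts G)))"
      using fin by (intro card_mono) auto
    also have "\<dots> = 2 ^ n * 2 ^ 2 ^ n"
      using fin that by (simp add: card_cartesian_product card_Pow)
    finally show ?thesis .
  qed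
  then show ?thesis
    by (intro finite_subset[OF _ finite_atMost[of "2 ^ n * 2 ^ 2 ^ n"]]) auto
qed

end

(* A linear forest with k edges is a set of k links, i.e. consecutive pairs, of an
   arrangement of all the vertices in a list, so G is free of the family iff every
   arrangement of its vertices has fewer than k links in G.  By an exchange of Ore type,
   joining two vertices whose degrees sum to at least k preserves this, so G may be assumed
   closed under this operation.  Remove vertices of degree at most a = (k - 1) div 2 one after
   the other.  Either nothing remains, or what remains is a clique of some size h <= k and
   every other vertex has degree at most k - h.  Counting the copies lost with each removed
   vertex gives a bound f(h), where b = k - a <= h <= k.  It is attained by the graph whose
   first h vertices form a clique and whose first k - h vertices are joined to all vertices.
   Finally f is convex, so its maximum is at h = k or h = b: these are the two terms. *)

theory Submission
  imports Defs
begin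

section \<open>Links of an arrangement and the closure\<close>

text \<open>The threshold \<open>a\<close> is the least number with 2a + 2 >= k: two vertices that
  survive the removal have degree at least a + 1 each, so in a closed graph they are adjacent. The
  same rule controls the removed vertices. A member of the surviving clique has degree at least h -
  1, hence an outside vertex of degree more than k - h would be joined to the whole clique and would
  have survived as well. Thus h is the only free parameter of the bound. The remaining difficulty is
  the maximum over h, since a product of convex functions need not be convex. The three summands are
  therefore arranged as products of nonnegative convex factors that are monotone in the same
  direction. The inequality k - h <= h is what makes the difference of binomial coefficients in the
  last summand convex and nonnegative.\<close>

fun links :: "'a list \<Rightarrow> 'a set set" where
  "links (x # y # zs) = insert {x, y} (links (y # zs))"
| "links _ = {}"

text \<open>Positions are counted instead of distinct pairs. This makes the count additive under
  concatenation and invariant under reversal even for lists with repetitions.\<close>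

fun weight :: "'a set set \<Rightarrow> 'a list \<Rightarrow> nat" where
  "weight E (x # y # zs) = of_bool ({x, y} \<in> E) + weight E (y # zs)"
| "weight E _ = 0"

lemma links_altdef: "links p = {{p ! i, p ! Suc i} | i. Suc i < length p}"
proof (induction p rule: links.induct)
  case (1 x y zs)
  have "{{(x # y # zs) ! i, (x # y # zs) ! Suc i} | i. Suc i < length (x # y # zs)} =
    insert {x, y} {{(y # zs) ! i, (y # zs) ! Suc i} | i. Suc i < length (y # zs)}"
    (is "?L = ?R")
  proof (intro equalityI subsetI)
    fix e assume "e \<in> ?L"
    then obtain i where i: "e = {(x # y # zs) ! i, (x # y # zs) ! Suc i}"
      "Suc i < length (x # y # zs)" by blast
    then show "e \<in> ?R" by (cases i) auto
  next
    fix e assume "e \<in> ?R"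
    then consider "e = {x, y}"
      | i where "e = {(y # zs) ! i, (y # zs) ! Suc i}" "Suc i < length (y # zs)" by blast
    then show "e \<in> ?L"
    proof cases
      case 1
      then show ?thesis by (intro CollectI exI[of _ 0]) auto
    next
      case (2 i)
      then show ?thesis by (intro CollectI exI[of _ "Suc i"]) auto
    qed
  qed
  with 1 show ?case by simp
qed auto

lemma links_subset_set: "e \<in> links p \<Longrightarrow> e \<subseteq> set p"
  by (induction p rule: links.induct) auto

lemma card_links: "distinct p \<Longrightarrow> e \<in> links p \<Longrightarrow> card e = 2"
  by (induction p rule: links.induct) auto

lemma finite_links [simp]: "finite (links p)"
  by (induction p rule: links.induct) auto

lemma links_append_subset: "links xs \<union> links ys \<subseteq> links (xs @ ys)"
proof (induction xs rule: links.induct)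
  case ("2_2" x)
  then show ?case by (cases ys) auto
qed auto

lemma links_map: "links (map f p) = (\<lambda>e. f ` e) ` links p"
  by (induction p rule: links.induct) auto

lemma weight_append:
  "xs \<noteq> [] \<Longrightarrow> ys \<noteq> [] \<Longrightarrow>
    weight E (xs @ ys) = weight E xs + of_bool ({last xs, hd ys} \<in> E) + weight E ys"
proof (induction xs rule: links.induct)
  case ("2_2" x)
  then show ?case by (cases ys) auto
qed auto

lemma weight_rev [simp]: "weight E (rev xs) = weight E xs"
proof (induction xs rule: links.induct)
  case (1 x y zs)
  then show ?case
    using weight_append[of "rev zs @ [y]" "[x]" E] by (simp add: insert_commute)
qed auto

lemma weight_eq_card: "distinct p \<Longrightarrow> weight E p = card (links p \<inter> E)"
proof (induction p rule: links.induct)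
  case (1 x y zs)
  have "{x, y} \<notin> links (y # zs)"
    using 1 links_subset_set[of "{x, y}" "y # zs"] by auto
  with 1 show ?case by (auto simp: Int_insert_left)
qed auto

lemma weight_Un_le: "weight (E \<union> F) p \<le> weight E p + weight F p"
  by (induction p rule: links.induct) auto

lemma weight_mono: "E \<subseteq> F \<Longrightarrow> weight E p \<le> weight F p"
  by (induction p rule: links.induct) (auto simp: of_bool_def)

lemma weight_insert:
  assumes "distinct p" 
  shows "weight (insert e E) p \<le> weight E p + of_bool (e \<in> links p)"
proof -
  have "links p \<inter> insert e E \<subseteq> (links p \<inter> E) \<union> (links p \<inter> {e})" by blast
  then have "card (links p \<inter> insert e E) \<le> card ((links p \<inter> E) \<union> (links p \<inter> {e}))"
    by (intro card_mono) auto
  also have "\<dots> \<le> card (links p \<inter> E) + card (links p \<inter> {e})" by (rule card_Un_le)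
  also have "card (links p \<inter> {e}) = of_bool (e \<in> links p)" by auto
  finally show ?thesis using assms by (simp add: weight_eq_card)
qed

lemma links_split:
  "{u, v} \<in> links p \<Longrightarrow> \<exists>xs ys. p = xs @ u # v # ys \<or> p = xs @ v # u # ys"
proof (induction p rule: links.induct)
  case (1 x y zs)
  then show ?case
    by (auto simp: doubleton_eq_iff) (metis append_Nil append_Cons)+
qed auto

section \<open>Arrangements with few links and the exchange argument\<close>

definition few_links :: "'a set \<Rightarrow> 'a set set \<Rightarrow> nat \<Rightarrow> bool" where
  "few_links V E k \<longleftrightarrow> (\<forall>p. distinct p \<longrightarrow> set p = V \<longrightarrow> weight E p < k)"

definition cweight :: "'a set set \<Rightarrow> 'a list \<Rightarrow> nat" where
  "cweight E c = weight E c + of_bool ({last c, hd c} \<in> E)"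

lemma cweight_rotate:
  assumes "xs \<noteq> []" "ys \<noteq> []"
  shows "cweight E (xs @ ys) = cweight E (ys @ xs)"
  using assms by (simp add: cweight_def weight_append)

text \<open>No edge meets \<open>z\<close>, so cutting the cycle open at \<open>z\<close> loses no
  link and leaves an arrangement of \<open>V\<close>.\<close>

lemma cweight_less:
  assumes "few_links V E k" "\<Union>E \<subseteq> V" "z \<notin> V" "V \<noteq> {}" "distinct c" "set c = insert z V"
  shows "cweight E c < k"
proof -
  obtain xs ys where c: "c = xs @ z # ys" using assms(6) by (metis insertI1 split_list)
  let ?p = "ys @ xs"
  have p: "distinct ?p" "set ?p = V" using assms c by auto
  then have ne: "?p \<noteq> []" using assms by auto
  have "cweight E c = cweight E ([z] @ ?p)"
    using cweight_rotate[of xs "z # ys" E] c by (cases "xs = []") auto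
  also have "\<dots> = weight E ?p"
  proof -
    have nz: "{z, x} \<notin> E" "{x, z} \<notin> E" for x using assms by auto
    then show ?thesis
      using ne unfolding cweight_def by (subst weight_append) auto
  qed
  also have "\<dots> < k" using assms p by (auto simp: few_links_def)
  finally show ?thesis .
qed

text \<open>Each consecutive pair is charged for its first entry under \<open>P\<close> and its
  second under \<open>Q\<close>. All entries but the last occur as first entries, all but the head
  as second ones.\<close>

lemma sum_consecutive_le:
  assumes "\<And>xs x y ys. c = xs @ x # y # ys \<Longrightarrow>
    of_bool (P x) + of_bool (Q y) \<le> (of_bool ({x, y} \<in> E) :: nat)"
  shows "length (filter P (butlast c)) + length (filter Q (tl c)) \<le> weight E c"
  using assms
proof (induction c rule: links.induct)
  case (1 x y zs)
  have "of_bool (P x) + of_bool (Q y) \<le> (of_bool ({x, y} \<in> E) :: nat)"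
    using 1(2)[of "[]"] by simp
  moreover have "length (filter P (butlast (y # zs))) + length (filter Q (tl (y # zs))) \<le> weight E (y # zs)"
  proof (rule 1(1))
    fix xs x' y' ys assume "y # zs = xs @ x' # y' # ys"
    then show "of_bool (P x') + of_bool (Q y') \<le> (of_bool ({x', y'} \<in> E) :: nat)"
      using 1(2)[of "x # xs"] by simp
  qed
  ultimately show ?case by (auto split: if_splits)
qed auto

text \<open>A fresh vertex \<open>z\<close>, isolated in \<open>E\<close>, closes an arrangement to a cyclic one, which is cut
  open between \<open>u\<close> and \<open>v\<close>; the rest is the exchange argument of Ore's theorem.\<close>

lemma degree_sum_le:
  fixes V :: "nat set"
  assumes "finite V" "few_links V E k" "\<Union>E \<subseteq> V" "\<And>e. e \<in> E \<Longrightarrow> card e = 2"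
    and uv: "{u, v} \<notin> E" and p: "distinct p" "set p = V" "p = xs @ u # v # ys"
    and max: "k \<le> Suc (weight E p)"
  shows "card {x \<in> V. {x, u} \<in> E} + card {y \<in> V. {y, v} \<in> E} \<le> weight E p"
proof -
  obtain z where z: "z \<notin> V" using assms(1) ex_new_if_finite by blast
  define c where "c = (v # ys) @ z # xs @ [u]"
  have nz: "{z, x} \<notin> E" "{x, z} \<notin> E" "{x, x} \<notin> E" for x
    using assms(3) z assms(4)[of "{x, x}"] by auto
  have c: "distinct c" "set c = insert z V" "last c = u" "hd c = v"
    using p z by (auto simp: c_def)
  have V: "V \<noteq> {}" using p by auto
  have "weight E c = weight E (v # ys) + weight E (z # xs @ [u])"
    unfolding c_def using nz by (subst weight_append) auto
  also have "weight E (z # xs @ [u]) = weight E (xs @ [u])"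
    using nz weight_append[of "[z]" "xs @ [u]" E] by simp
  also have "weight E (v # ys) + weight E (xs @ [u]) = weight E p"
    using uv weight_append[of "xs @ [u]" "v # ys" E] p by simp
  finally have wc: "weight E c = weight E p" .
  have "length (filter (\<lambda>x. {x, u} \<in> E) (butlast c)) + length (filter (\<lambda>y. {y, v} \<in> E) (tl c))
      \<le> weight E c"
  proof (rule sum_consecutive_le)
    fix X x y Y assume split: "c = X @ x # y # Y"
    \<comment> \<open>Reversing \<open>c\<close> from \<open>y\<close> on exchanges, cyclically, {x,
      y} and the missing {u, v} for {x, u} and {y, v}. The new cyclic weight is below k, which is at
      most \<open>weight E c\<close> + 1, so the links gained do not outnumber the link
      lost.\<close>
    define c' where "c' = (X @ [x]) @ rev (y # Y)"
    have eq: "distinct c'" "set c' = insert z V" "last c' = y" "hd c' = v" "last (y # Y) = u"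
      using c split by (auto simp: c'_def hd_append)
    have "weight E c = weight E (X @ [x]) + of_bool ({x, y} \<in> E) + weight E (y # Y)"
      using weight_append[of "X @ [x]" "y # Y" E] split by simp
    moreover have "weight E c' = weight E (X @ [x]) + of_bool ({x, u} \<in> E) + weight E (y # Y)"
      using weight_append[of "X @ [x]" "rev (y # Y)" E]
      by (simp only: c'_def hd_rev eq(5) weight_rev last_snoc) simp
    moreover have "cweight E c' < k"
      using cweight_less[OF assms(2,3) z V eq(1,2)] .
    ultimately show "of_bool ({x, u} \<in> E) + of_bool ({y, v} \<in> E) \<le> (of_bool ({x, y} \<in> E) :: nat)"
      using max wc eq by (simp add: cweight_def)
  qed
  \<comment> \<open>\<open>butlast c\<close> omits only \<open>u\<close>, and neither
    \<open>u\<close> nor the additional \<open>z\<close> is adjacent to \<open>u\<close>, so the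
    filter counts the degree of \<open>u\<close>.\<close>
  moreover have "length (filter (\<lambda>x. {x, u} \<in> E) (butlast c)) = card {x \<in> V. {x, u} \<in> E}"
  proof -
    have "set c = insert u (set (butlast c))"
      using c by (metis append_butlast_last_id c_def append_is_Nil_conv list.distinct(1) list.simps(15)
        rotate1.simps(2) set_rotate1)
    then have "x \<in> set (butlast c) \<longleftrightarrow> x \<in> V" if "{x, u} \<in> E" for x
      using nz(1,3) c(2) that by (metis insert_iff)
    then have "{x. {x, u} \<in> E} \<inter> set (butlast c) = {x \<in> V. {x, u} \<in> E}" by blast
    then show ?thesis using c by (simp add: distinct_length_filter distinct_butlast)
  qed
  moreover have "length (filter (\<lambda>y. {y, v} \<in> E) (tl c)) = card {y \<in> V. {y, v} \<in> E}"
  proof -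
    have "set c = insert v (set (tl c))" by (simp add: c_def)
    then have "x \<in> set (tl c) \<longleftrightarrow> x \<in> V" if "{x, v} \<in> E" for x
      using nz(1,3) c(2) that by (metis insert_iff)
    then have "{x. {x, v} \<in> E} \<inter> set (tl c) = {x \<in> V. {x, v} \<in> E}" by blast
    then show ?thesis using c by (simp add: distinct_length_filter distinct_tl)
  qed
  ultimately show ?thesis using wc by simp
qed

text \<open>An arrangement with k links must use the new one, hence has k - 1 old links. The
  exchange argument then bounds the degree sum by k - 1.\<close>

lemma few_links_insert:
  fixes V :: "nat set"
  assumes "finite V" "few_links V E k" "\<Union>E \<subseteq> V" "\<And>e. e \<in> E \<Longrightarrow> card e = 2"
    and "{u, v} \<notin> E" and deg: "k \<le> card {x \<in> V. {x, u} \<in> E} + card {y \<in> V. {y, v} \<in> E}"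
  shows "few_links V (insert {u, v} E) k"
  unfolding few_links_def
proof (intro allI impI, rule ccontr)
  fix p assume p: "distinct p" "set p = V" "\<not> weight (insert {u, v} E) p < k"
  have lt: "weight E p < k" using p assms(2) by (auto simp: few_links_def)
  then have "{u, v} \<in> links p" "k \<le> Suc (weight E p)"
    using weight_insert[OF p(1), of "{u, v}" E] p(3) by (auto simp: of_bool_def split: if_splits)
  then obtain xs ys where "p = xs @ u # v # ys \<or> p = xs @ v # u # ys"
    using links_split by metis
  then have "card {x \<in> V. {x, u} \<in> E} + card {y \<in> V. {y, v} \<in> E} \<le> weight E p"
  proof
    assume "p = xs @ u # v # ys"
    from degree_sum_le[OF assms(1-5) p(1,2) this \<open>k \<le> Suc _\<close>] show ?thesis .
  next
    assume "p = xs @ v # u # ys"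
    from degree_sum_le[OF assms(1-4) _ p(1,2) this \<open>k \<le> Suc _\<close>] show ?thesis
      using assms(5) by (simp add: insert_commute)
  qed
  then show False using deg lt by linarith
qed

text \<open>An arrangement that lists the clique first has at least \<open>card H\<close> - 1
  links.\<close>

lemma few_links_clique:
  assumes "finite V" "few_links V E k" "H \<subseteq> V" "H \<noteq> {}"
    "\<And>x y. x \<in> H \<Longrightarrow> y \<in> H \<Longrightarrow> x \<noteq> y \<Longrightarrow> {x, y} \<in> E"
  shows "card H \<le> k"
proof -
  obtain hs where hs: "distinct hs" "set hs = H"
    using assms finite_distinct_list finite_subset by metis
  obtain rs where rs: "distinct rs" "set rs = V - H"
    using assms finite_distinct_list finite_Diff by metis
  have "set xs \<subseteq> H \<Longrightarrow> distinct xs \<Longrightarrow> xs \<noteq> [] \<Longrightarrow> Suc (weight E xs) = length xs" for xs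
    by (induction xs rule: links.induct) (auto simp: assms(5))
  then have "length hs = Suc (weight E hs)" using hs assms(4) by force
  moreover have "hs \<noteq> []" using hs assms(4) by auto
  then have "weight E hs \<le> weight E (hs @ rs)"
    by (cases "rs = []") (auto simp: weight_append)
  moreover have "weight E (hs @ rs) < k"
    using assms hs rs unfolding few_links_def by (metis Diff_disjoint Diff_partition distinct_append set_append)
  ultimately show ?thesis using hs distinct_card by force
qed

section \<open>Convexity of the bound\<close>

text \<open>For a <= b this is the number of stars in the graph on n vertices whose first b vertices
  form a clique and whose first a vertices are joined to all others. The summands sort the stars by
  their clique part: inside the first a vertices; containing one vertex beyond the first b, which
  forces everything else into the first a; inside the first b but not inside the first a.\<close>

definition star_bound :: "nat \<Rightarrow> nat \<Rightarrow> nat \<Rightarrow> nat \<Rightarrow> nat \<Rightarrow> nat" where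
  "star_bound n s t a b = (a choose s) * ((n - s) choose t)
    + (n - b) * (a choose (s - 1)) * ((a + 1 - s) choose t)
    + ((b choose s) - (a choose s)) * ((b - s) choose t)"

definition cvx :: "nat \<Rightarrow> nat \<Rightarrow> (nat \<Rightarrow> int) \<Rightarrow> bool" where
  "cvx l u f \<longleftrightarrow> (\<forall>x. l \<le> x \<longrightarrow> x + 2 \<le> u \<longrightarrow> 2 * f (x + 1) \<le> f x + f (x + 2))"

lemma cvx_add: "cvx l u f \<Longrightarrow> cvx l u g \<Longrightarrow> cvx l u (\<lambda>x. f x + g x)"
  unfolding cvx_def by (smt (verit))

lemma cvx_cong: "cvx l u f \<Longrightarrow> (\<And>x. l \<le> x \<Longrightarrow> x \<le> u \<Longrightarrow> f x = g x) \<Longrightarrow> cvx l u g"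
  unfolding cvx_def by auto

lemma cvx_cmult: "0 \<le> c \<Longrightarrow> cvx l u f \<Longrightarrow> cvx l u (\<lambda>x. c * f x)"
  unfolding cvx_def by (metis distrib_left mult.left_commute mult_left_mono)

text \<open>Convexity gives 4 f(x+1) g(x+1) <= (f(x) + f(x+2)) (g(x) + g(x+2)). The right side is
  twice the desired sum minus a product of two increments, which have the same sign by
  monotonicity.\<close>

lemma cvx_mult_incr:
  assumes "cvx l u f" "cvx l u g" "mono_on {l..u} f" "mono_on {l..u} g"
    "\<And>x. x \<in> {l..u} \<Longrightarrow> 0 \<le> f x" "\<And>x. x \<in> {l..u} \<Longrightarrow> 0 \<le> g x"
  shows "cvx l u (\<lambda>x. f x * g x)"
  unfolding cvx_def
proof (intro allI impI)
  fix x assume x: "l \<le> x" "x + 2 \<le> u"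
  have le: "f x \<le> f (x + 2)" "g x \<le> g (x + 2)"
    using x assms(3,4) by (auto simp: mono_on_def)
  have "4 * (f (x + 1) * g (x + 1)) = (2 * f (x + 1)) * (2 * g (x + 1))" by simp
  also have "\<dots> \<le> (f x + f (x + 2)) * (g x + g (x + 2))"
    using x assms(1,2,5,6) by (intro mult_mono) (auto simp: cvx_def)
  also have "\<dots> = 2 * (f x * g x + f (x + 2) * g (x + 2)) - (f (x + 2) - f x) * (g (x + 2) - g x)"
    by (simp add: algebra_simps)
  also have "\<dots> \<le> 2 * (f x * g x + f (x + 2) * g (x + 2))" using le by simp
  finally show "2 * (f (x + 1) * g (x + 1)) \<le> f x * g x + f (x + 2) * g (x + 2)" by simp
qed

lemma cvx_mult_decr:
  assumes "cvx l u f" "cvx l u g" "antimono_on {l..u} f" "antimono_on {l..u} g"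
    "\<And>x. x \<in> {l..u} \<Longrightarrow> 0 \<le> f x" "\<And>x. x \<in> {l..u} \<Longrightarrow> 0 \<le> g x"
  shows "cvx l u (\<lambda>x. f x * g x)"
  unfolding cvx_def
proof (intro allI impI)
  fix x assume x: "l \<le> x" "x + 2 \<le> u"
  have le: "f (x + 2) \<le> f x" "g (x + 2) \<le> g x"
    using x assms(3,4) by (auto simp: monotone_on_def)
  have "4 * (f (x + 1) * g (x + 1)) = (2 * f (x + 1)) * (2 * g (x + 1))" by simp
  also have "\<dots> \<le> (f x + f (x + 2)) * (g x + g (x + 2))"
    using x assms(1,2,5,6) by (intro mult_mono) (auto simp: cvx_def)
  also have "\<dots> = 2 * (f x * g x + f (x + 2) * g (x + 2)) - (f x - f (x + 2)) * (g x - g (x + 2))"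
    by (simp add: algebra_simps)
  also have "\<dots> \<le> 2 * (f x * g x + f (x + 2) * g (x + 2))" using le by simp
  finally show "2 * (f (x + 1) * g (x + 1)) \<le> f x * g x + f (x + 2) * g (x + 2)" by simp
qed

text \<open>Once a convex function increases, it keeps increasing. If \<open>f x\<close> exceeds
  \<open>f l\<close>, there is an increase before \<open>x\<close>, and it persists up to
  \<open>u\<close>.\<close>

lemma cvx_le_max:
  assumes "cvx l u f" "l \<le> x" "x \<le> u"
  shows "f x \<le> max (f l) (f u)"
proof (rule ccontr)
  assume contr: "\<not> ?thesis"
  have "f x \<le> f l"
    if "\<forall>y. l \<le> y \<longrightarrow> y < x \<longrightarrow> f (Suc y) \<le> f y"
    using \<open>l \<le> x\<close> that
  proof (induction x rule: dec_induct)
    case (step n)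
    then show ?case by (meson less_Suc_eq order.trans lessI)
  qed simp
  then obtain y where y: "l \<le> y" "y < x" "f y < f (Suc y)"
    using contr by force
  have up: "f z < f (Suc z)" if "y \<le> z" "Suc z \<le> u" for z
    using that
  proof (induction z rule: dec_induct)
    case (step z)
    have "2 * f (z + 1) \<le> f z + f (z + 2)" using assms(1) y step by (auto simp: cvx_def)
    then show ?case using step by simp
  qed (use y in simp)
  have "f x \<le> f z" if "x \<le> z" "z \<le> u" for z
    using that
  proof (induction z rule: dec_induct)
    case (step z)
    then have "f x \<le> f z" by simp
    also have "f z < f (Suc z)" using step y by (intro up) auto
    finally show ?case by simp
  qed simp
  from this[OF \<open>x \<le> u\<close> order.refl] have "f x \<le> f u" .
  then show False using contr by simp
qed

lemma choose_Suc_Suc_eq: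
  "((x + 2) choose (s + 2)) + (x choose (s + 2)) = 2 * ((x + 1) choose (s + 2)) + (x choose s)"
  by (simp add: numeral_2_eq_2)

lemma choose_second_difference:
  "int ((x + 2) choose s) + int (x choose s) - 2 * int ((x + 1) choose s) =
    (if s < 2 then 0 else int (x choose (s - 2)))"
proof -
  consider "s = 0" | "s = 1" | s' where "s = s' + 2"
    by (metis One_nat_def add_2_eq_Suc' not0_implies_Suc)
  then show ?thesis
  proof cases
    case (3 s')
    then show ?thesis using choose_Suc_Suc_eq[of x s'] by simp
  qed auto
qed

lemma cvx_choose: "cvx l u (\<lambda>x. int (x choose s))"
  unfolding cvx_def
proof (intro allI impI)
  fix x
  show "2 * int ((x + 1) choose s) \<le> int (x choose s) + int ((x + 2) choose s)"
    using choose_second_difference[of x s] by (simp split: if_splits)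
qed

text \<open>The truncation of the subtraction does no harm, since \<open>0 choose t = 1 choose t = 0\<close>.\<close>

lemma cvx_choose_diff:
  assumes "2 \<le> t"
  shows "cvx l u (\<lambda>x. int ((x - s) choose t))"
  unfolding cvx_def
proof (intro allI impI)
  fix x
  show "2 * int ((x + 1 - s) choose t) \<le> int ((x - s) choose t) + int ((x + 2 - s) choose t)"
  proof (cases "s \<le> x")
    case True
    then show ?thesis using cvx_choose[of 0 "x - s + 2" t] by (auto simp: cvx_def Suc_diff_le)
  next
    case False
    then have "x + 1 - s = 0" by simp
    then show ?thesis using assms by (simp add: binomial_eq_0)
  qed
qed

lemma cvx_reflect:
  assumes "cvx 0 k f" 
  shows "cvx 0 k (\<lambda>x. f (k - x))"
  unfolding cvx_def
proof (intro allI impI)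
  fix x assume "x + 2 \<le> k"
  then have "2 * f (k - (x + 2) + 1) \<le> f (k - (x + 2)) + f (k - (x + 2) + 2)"
    using assms by (auto simp: cvx_def)
  moreover have "k - (x + 2) + 1 = k - (x + 1)" "k - (x + 2) + 2 = k - x"
    using \<open>x + 2 \<le> k\<close> by auto
  ultimately show "2 * f (k - (x + 1)) \<le> f (k - x) + f (k - (x + 2))" by simp
qed

lemma cvx_subinterval: "cvx 0 k f \<Longrightarrow> cvx l k f"
  by (auto simp: cvx_def)

text \<open>Both sides count the disjoint pairs of an s-set and a t-set inside an a-set.\<close>

lemma choose_mult_choose: 
  "((a choose (s + t)) * ((s + t) choose t) :: nat) = (a choose s) * ((a - s) choose t)"
proof (cases "s + t \<le> a")
  case True
  then show ?thesis
    using choose_mult[of t "s + t" a] choose_mult[of s "s + t" a] binomial_symmetric[of t "s + t"]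
    by simp
next
  case False
  then have "a - s < t \<or> a < s" by auto
  then show ?thesis using False by (auto simp: binomial_eq_0)
qed

text \<open>The first summand is a constant times a reflected binomial coefficient, the second a
  product of decreasing factors, the third a product of increasing ones.\<close>

lemma cvx_star_bound:
  assumes s: "1 \<le> s" and t: "2 \<le> t" and b: "k \<le> 2 * l" and n: "k \<le> n"
  shows "cvx l k (\<lambda>h. int (star_bound n s t (k - h) h))"
proof -
  define g where "g h = int (h choose s) - int ((k - h) choose s)" for h
  have mirror: "cvx l k (\<lambda>h. int ((k - h) choose j))" for j
    by (rule cvx_subinterval[OF cvx_reflect[OF cvx_choose]])
  have "cvx l k (\<lambda>h. g h * int ((h - s) choose t))"
  proof (rule cvx_mult_incr)
    show "cvx l k g"
      unfolding cvx_def
    proof (intro allI impI)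
      fix x assume x: "l \<le> x" "x + 2 \<le> k"
      define y where "y = k - (x + 2)"
      have eqs: "k - (x + 1) = y + 1" "k - x = y + 2" "k - (x + 2) = y" and "y \<le> x"
        using x b by (auto simp: y_def)
      \<comment> \<open>The second difference of \<open>g\<close> at \<open>x\<close> is the
        difference of these two binomial coefficients, and 0 if s < 2.\<close>
      have "int (y choose (s - 2)) \<le> int (x choose (s - 2))"
        using binomial_right_mono[OF \<open>y \<le> x\<close>] by simp
      then show "2 * g (x + 1) \<le> g x + g (x + 2)"
        using choose_second_difference[of x s] choose_second_difference[of y s]
        unfolding g_def eqs by (smt (verit))
    qed
    show "mono_on {l..k} g"
      unfolding g_def mono_on_def by (auto intro!: diff_mono binomial_right_mono)
    show "0 \<le> g x" if "x \<in> {l..k}" for x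
      using that b by (auto simp: g_def intro!: binomial_right_mono)
    show "mono_on {l..k} (\<lambda>h. int ((h - s) choose t))"
      by (auto simp: mono_on_def intro!: binomial_right_mono)
  qed (use t in \<open>auto intro: cvx_choose_diff\<close>)
  moreover have "cvx l k (\<lambda>h. int ((n - s) choose t) * int ((k - h) choose s))"
    by (intro cvx_cmult mirror) simp
  moreover have "cvx l k (\<lambda>h. int (n - h) * (int ((s + t - 1) choose t) * int ((k - h) choose (s + t - 1))))"
  proof (rule cvx_mult_decr)
    show "cvx l k (\<lambda>h. int (n - h))" using n by (auto simp: cvx_def)
    show "cvx l k (\<lambda>h. int ((s + t - 1) choose t) * int ((k - h) choose (s + t - 1)))"
      by (intro cvx_cmult mirror) simp
  qed (auto simp: monotone_on_def intro!: mult_left_mono binomial_right_mono)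
  ultimately have "cvx l k (\<lambda>h. int ((n - s) choose t) * int ((k - h) choose s)
     + int (n - h) * (int ((s + t - 1) choose t) * int ((k - h) choose (s + t - 1)))
     + g h * int ((h - s) choose t))"
    by (intro cvx_add)
  then show ?thesis
  proof (rule cvx_cong)
    fix h assume h: "l \<le> h" "h \<le> k"
    have "(k - h) choose s \<le> h choose s" using h b by (intro binomial_right_mono) auto
    \<comment> \<open>Two factors depending on h become a single binomial coefficient in k - h times
      a constant, the form used for the second summand above.\<close>
    moreover have "((k - h) choose (s - 1)) * ((k - h + 1 - s) choose t) =
        ((k - h) choose (s + t - 1)) * ((s + t - 1) choose t)"
    proof -
      have "k - h + 1 - s = k - h - (s - 1)" "s + t - 1 = s - 1 + t" using s by auto
      then show ?thesis by (simp only: choose_mult_choose)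
    qed
    ultimately show "int ((n - s) choose t) * int ((k - h) choose s)
     + int (n - h) * (int ((s + t - 1) choose t) * int ((k - h) choose (s + t - 1)))
     + g h * int ((h - s) choose t) = int (star_bound n s t (k - h) h)"
      by (simp add: star_bound_def g_def of_nat_diff mult.assoc)
  qed
qed

lemma star_bound_le_max:
  assumes "1 \<le> s" "2 \<le> t" "k \<le> 2 * b" "b \<le> h" "h \<le> k" "k \<le> n"
  shows "star_bound n s t (k - h) h \<le> max (star_bound n s t 0 k) (star_bound n s t (k - b) b)"
  using cvx_le_max[OF cvx_star_bound[OF assms(1,2,3,6)] assms(4,5)] by simp

section \<open>Counting stars in degenerate graphs\<close>

lemma card_disjoint_pairs:
  assumes "finite B" "A \<subseteq> B"
  shows "card (SIGMA S:{S. S \<subseteq> A \<and> card S = i}. {T. T \<subseteq> B - S \<and> card T = j}) =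
    (card A choose i) * ((card B - i) choose j)"
proof -
  have fin: "finite A" using assms finite_subset by blast
  have "card {T. T \<subseteq> B - S \<and> card T = j} = (card B - i) choose j"
    if "S \<in> {S. S \<subseteq> A \<and> card S = i}" for S
    using that assms n_subsets[of "B - S" j] by (auto simp: card_Diff_subset finite_subset)
  then have "card (SIGMA S:{S. S \<subseteq> A \<and> card S = i}. {T. T \<subseteq> B - S \<and> card T = j}) =
      (\<Sum>S \<in> {S. S \<subseteq> A \<and> card S = i}. (card B - i) choose j)"
    using fin assms by (subst card_SigmaI) auto
  then show ?thesis using n_subsets[OF fin, of i] by simp
qed

text \<open>A pair stands for a copy of \<open>K_star s t\<close>: \<open>S\<close> is the clique,
  \<open>T\<close> the leaves. Edges inside \<open>T\<close> are unconstrained, because copies need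
  not be induced. The vertex set is a separate argument, so that vertices can be deleted while
  \<open>E\<close> stays fixed.\<close>

definition stars :: "'a set \<Rightarrow> 'a set set \<Rightarrow> nat \<Rightarrow> nat \<Rightarrow> ('a set \<times> 'a set) set" where
  "stars V E s t = {(S, T). S \<subseteq> V \<and> T \<subseteq> V - S \<and> card S = s \<and> card T = t \<and>
     (\<forall>x \<in> S. \<forall>y \<in> S \<union> T. x \<noteq> y \<longrightarrow> {x, y} \<in> E)}"

lemma finite_stars [simp]: "finite V \<Longrightarrow> finite (stars V E s t)"
  by (rule finite_subset[of _ "Pow V \<times> Pow V"]) (auto simp: stars_def)

lemma stars_mono: "E \<subseteq> F \<Longrightarrow> stars V E s t \<subseteq> stars V F s t"
  by (auto simp: stars_def)

lemma card_stars_le: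
  assumes "finite V"
  shows "card (stars V E s t) \<le> (card V choose s) * ((card V - s) choose t)"
proof -
  have "stars V E s t \<subseteq>
      (SIGMA S:{S. S \<subseteq> V \<and> card S = s}. {T. T \<subseteq> V - S \<and> card T = t})"
    by (auto simp: stars_def)
  moreover have "finite \<dots>" using assms by (intro finite_SigmaI) auto
  ultimately show ?thesis
    by (simp only: card_mono flip: card_disjoint_pairs[OF assms subset_refl])
qed

text \<open>If \<open>v\<close> lies in the clique of a star, all other vertices of the star are
  neighbours of \<open>v\<close>. If \<open>v\<close> is a leaf, only the clique must consist of
  neighbours, and the other leaves are arbitrary.\<close>

lemma card_stars_delete_vertex:
  assumes fin: "finite W" and v: "v \<in> W" and deg: "card {u \<in> W. u \<noteq> v \<and> {u, v} \<in> E} \<le> d"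
    and s: "1 \<le> s" and t: "1 \<le> t"
  shows "card (stars W E s t) \<le> card (stars (W - {v}) E s t)
    + (d choose (s - 1)) * ((d - (s - 1)) choose t)
    + (d choose s) * ((card W - 1 - s) choose (t - 1))"
proof -
  define N where "N = {u \<in> W. u \<noteq> v \<and> {u, v} \<in> E}"
  have N: "finite N" "N \<subseteq> W - {v}" using fin by (auto simp: N_def)
  define P where "P = (SIGMA S:{S. S \<subseteq> N \<and> card S = s - 1}. {T. T \<subseteq> N - S \<and> card T = t})"
  define Q where "Q = (SIGMA S:{S. S \<subseteq> N \<and> card S = s}. {T. T \<subseteq> W - {v} - S \<and> card T = t - 1})"
  have finPQ: "finite P" "finite Q" unfolding P_def Q_def using fin N by (auto intro!: finite_SigmaI)
  have "stars W E s t \<subseteq> stars (W - {v}) E s t \<union> (\<lambda>(S, T). (insert v S, T)) ` P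
      \<union> (\<lambda>(S, T). (S, insert v T)) ` Q"
  proof
    fix X assume X: "X \<in> stars W E s t"
    obtain S T where ST: "X = (S, T)" by (cases X)
    have sub: "S \<subseteq> W" "T \<subseteq> W - S" "card S = s" "card T = t"
      and edge: "\<And>x y. x \<in> S \<Longrightarrow> y \<in> S \<union> T \<Longrightarrow> x \<noteq> y \<Longrightarrow> {x, y} \<in> E"
      using X ST by (auto simp: stars_def)
    consider "v \<in> S" | "v \<in> T" | "v \<notin> S" "v \<notin> T" by blast
    then show "X \<in> stars (W - {v}) E s t \<union> (\<lambda>(S, T). (insert v S, T)) ` P
      \<union> (\<lambda>(S, T). (S, insert v T)) ` Q"
    proof cases
      case 1
      have "(S - {v}, T) \<in> P"
        using sub 1 edge[of v] by (auto simp: P_def N_def insert_commute)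
      moreover have "X = (\<lambda>(S, T). (insert v S, T)) (S - {v}, T)" using 1 ST by auto
      ultimately show ?thesis by blast
    next
      case 2
      have "(S, T - {v}) \<in> Q"
        using sub 2 edge[of _ v] by (auto simp: Q_def N_def)
      moreover have "X = (\<lambda>(S, T). (S, insert v T)) (S, T - {v})" using 2 ST by auto
      ultimately show ?thesis by blast
    next
      case 3
      then show ?thesis using sub edge ST by (auto simp: stars_def)
    qed
  qed
  then have "card (stars W E s t) \<le> card (stars (W - {v}) E s t \<union> (\<lambda>(S, T). (insert v S, T)) ` P
      \<union> (\<lambda>(S, T). (S, insert v T)) ` Q)"
    using fin finPQ by (intro card_mono) auto
  also have "\<dots> \<le> card (stars (W - {v}) E s t) + card P + card Q"
    using card_image_le[OF finPQ(1)] card_image_le[OF finPQ(2)]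
    by (intro order.trans[OF card_Un_le] add_mono) auto
  also have "card P = (card N choose (s - 1)) * ((card N - (s - 1)) choose t)"
    unfolding P_def by (rule card_disjoint_pairs[OF N(1) subset_refl])
  also have "\<dots> \<le> (d choose (s - 1)) * ((d - (s - 1)) choose t)"
    using deg by (intro mult_le_mono binomial_right_mono diff_le_mono) (simp_all add: N_def)
  also have "card Q = (card N choose s) * ((card (W - {v}) - s) choose (t - 1))"
    unfolding Q_def using fin N by (intro card_disjoint_pairs) auto
  also have "card (W - {v}) = card W - 1" using v by simp
  also have "(card N choose s) * ((card W - 1 - s) choose (t - 1))
      \<le> (d choose s) * ((card W - 1 - s) choose (t - 1))"
    using deg by (intro mult_le_mono binomial_right_mono) (simp_all add: N_def)
  finally show ?thesis by simp
qed

text \<open>The loss bounded in \<open>card_stars_delete_vertex\<close> is exactly the increment of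
  \<open>star_bound\<close> in its first argument, so the bounds telescope as vertices are deleted
  until h remain.\<close>

lemma card_stars_degenerate:
  assumes "finite W" "d \<le> h" "1 \<le> s" "1 \<le> t" "h \<le> card W"
    and deg: "\<And>U. U \<subseteq> W \<Longrightarrow> h < card U \<Longrightarrow>
      \<exists>v \<in> U. card {u \<in> U. u \<noteq> v \<and> {u, v} \<in> E} \<le> d"
  shows "card (stars W E s t) \<le> star_bound (card W) s t d h"
proof -
  have "card (stars W E s t) \<le> star_bound m s t d h"
    if "h \<le> m" "card W = m" "finite W"
      "\<And>U. U \<subseteq> W \<Longrightarrow> h < card U \<Longrightarrow> \<exists>v \<in> U. card {u \<in> U. u \<noteq> v \<and> {u, v} \<in> E} \<le> d"
    for m W
    using that
  proof (induction m arbitrary: W rule: dec_induct)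
    case base
    \<comment> \<open>With h vertices left the middle summand is 0 and the other two add up to the
      trivial bound for h vertices.\<close>
    have "(d choose s) * x + ((h choose s) - (d choose s)) * x = (h choose s) * x" for x
      using binomial_right_mono[OF \<open>d \<le> h\<close>, of s] by (metis add_mult_distrib le_add_diff_inverse)
    then show ?case
      using card_stars_le[OF base.prems(2), of E s t] base.prems(1) by (simp add: star_bound_def)
  next
    case (step m)
    note cW = step.prems(1)
    then have "h < card W" using step.hyps by simp
    then obtain v where v: "v \<in> W" "card {u \<in> W. u \<noteq> v \<and> {u, v} \<in> E} \<le> d"
      using step.prems(3)[OF subset_refl] by blast
    have m: "card (W - {v}) = m" using cW v by simp
    have "card (stars (W - {v}) E s t) \<le> star_bound m s t d h"
    proof (rule step.IH)
      show "\<exists>w \<in> U. card {u \<in> U. u \<noteq> w \<and> {u, w} \<in> E} \<le> d"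
        if "U \<subseteq> W - {v}" "h < card U" for U
        using that by (intro step.prems(3)) auto
    qed (use m step.prems(2) in simp_all)
    moreover have "card (stars W E s t) \<le> card (stars (W - {v}) E s t)
      + (d choose (s - 1)) * ((d - (s - 1)) choose t)
      + (d choose s) * ((card W - 1 - s) choose (t - 1))"
      using card_stars_delete_vertex[OF step.prems(2) v] assms by blast
    moreover have "star_bound (Suc m) s t d h = star_bound m s t d h
      + (d choose (s - 1)) * ((d - (s - 1)) choose t) + (d choose s) * ((m - s) choose (t - 1))"
    proof -
      \<comment> \<open>Pascal's rule needs s <= m, which follows from s <= d; for s > d the factor
        \<open>d choose s\<close> is 0.\<close>
      have 1: "(d choose s) * ((Suc m - s) choose t) =
          (d choose s) * ((m - s) choose t) + (d choose s) * ((m - s) choose (t - 1))"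
      proof (cases "s \<le> d")
        case True
        then have "Suc m - s = Suc (m - s)" using step.hyps \<open>d \<le> h\<close> by simp
        moreover obtain t' where "t = Suc t'" using \<open>1 \<le> t\<close> by (cases t) auto
        ultimately show ?thesis by (simp add: add_mult_distrib2)
      next
        case False
        then show ?thesis by (simp add: binomial_eq_0)
      qed
      have 2: "Suc m - h = Suc (m - h)" using step.hyps by simp
      have 3: "d + 1 - s = d - (s - 1)" using \<open>1 \<le> s\<close> by simp
      show ?thesis unfolding star_bound_def 1 2 3 by (simp add: add_mult_distrib)
    qed
    ultimately show ?case by (simp add: cW)
  qed
  from this[OF assms(5) refl assms(1) deg] show ?thesis .
qed

section \<open>Linear forests as sets of links\<close>

definition adjacency :: "'a set set \<Rightarrow> ('a \<times> 'a) set" where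
  "adjacency E = {(x, y). {x, y} \<in> E}"

lemma sym_adjacency_rtrancl: "sym ((adjacency E)\<^sup>*)"
  by (rule sym_rtrancl) (auto simp: sym_def adjacency_def insert_commute)

lemma links_connected:
  assumes "x \<in> set q" "y \<in> set q"
  shows "(x, y) \<in> (adjacency (links q))\<^sup>*"
proof -
  have hd: "(hd q, x) \<in> (adjacency (links q))\<^sup>*" if "x \<in> set q" for x
    using that
  proof (induction q arbitrary: x rule: links.induct)
    case (1 a b zs)
    have mono: "(adjacency (links (b # zs)))\<^sup>* \<subseteq> (adjacency (links (a # b # zs)))\<^sup>*"
      by (intro rtrancl_mono) (auto simp: adjacency_def)
    show ?case
    proof (cases "x = a")
      case False
      then have "(b, x) \<in> (adjacency (links (b # zs)))\<^sup>*" using 1 by force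
      with mono have "(b, x) \<in> (adjacency (links (a # b # zs)))\<^sup>*" by blast
      moreover have "(a, b) \<in> adjacency (links (a # b # zs))" by (simp add: adjacency_def)
      ultimately show ?thesis by (simp add: converse_rtrancl_into_rtrancl)
    qed simp
  qed auto
  show ?thesis
    using symD[OF sym_adjacency_rtrancl hd[OF assms(1)]] hd[OF assms(2)] by (rule rtrancl_trans)
qed

text \<open>Cutting \<open>p\<close> at every link outside \<open>F\<close> leaves runs whose links
  make up \<open>F\<close>. They will be the components.\<close>

lemma split_runs:
  assumes "distinct p" "F \<subseteq> links p"
  shows "\<exists>ps. concat ps = p \<and> [] \<notin> set ps \<and> F = \<Union> (links ` set ps)"
  using assms
proof (induction p arbitrary: F rule: links.induct)
  case (1 x y zs)
  define F' where "F' = F - {{x, y}}"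
  have "distinct (y # zs)" "F' \<subseteq> links (y # zs)" using "1.prems" by (auto simp: F'_def)
  from "1.IH"[OF this] obtain ps
    where ps: "concat ps = y # zs" "[] \<notin> set ps" "F' = \<Union> (links ` set ps)" by blast
  show ?case
  proof (cases "{x, y} \<in> F")
    case True
    obtain q qs where q: "ps = (y # q) # qs"
      using ps by (cases ps; cases "hd ps") auto
    have "F = insert {x, y} F'" using True by (auto simp: F'_def)
    then show ?thesis
      using ps q by (intro exI[of _ "(x # y # q) # qs"]) auto
  next
    case False
    then have "F = F'" by (auto simp: F'_def)
    then show ?thesis using ps by (intro exI[of _ "[x] # ps"]) auto
  qed
next
  case "2_1"
  then show ?case by (intro exI[of _ "[]"]) auto
next
  case ("2_2" x)
  then show ?case by (intro exI[of _ "[[x]]"]) auto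
qed

lemma disjoint_runs:
  assumes "distinct (concat ps)" "q \<in> set ps" "r \<in> set ps" "x \<in> set q" "x \<in> set r"
  shows "q = r"
  using assms by (induction ps) auto

text \<open>The runs are disjoint, so an edge of \<open>F\<close> that meets a run is a link of this
  run; hence no walk leaves the run in which it starts.\<close>

lemma linear_forest_of_list:
  assumes "distinct p" "F \<subseteq> links p"
  shows "linear_forest (set p, F)"
  unfolding linear_forest_def
proof (intro conjI ballI)
  show "simple_graph (set p, F)"
    using assms links_subset_set card_links unfolding simple_graph_def by fastforce
  obtain ps where ps: "concat ps = p" "[] \<notin> set ps" "F = \<Union> (links ` set ps)"
    using split_runs[OF assms] by blast
  fix v assume "v \<in> verts (set p, F)"
  then obtain q where q: "q \<in> set ps" "v \<in> set q" using ps by auto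
  have qp: "set q \<subseteq> set p" "distinct q" "q \<noteq> []"
    using q ps assms(1) by (auto simp: distinct_concat_iff)
  have within: "e \<in> links q" if e: "e \<in> F" "x \<in> e" "x \<in> set q" for e x
  proof -
    obtain r where r: "r \<in> set ps" "e \<in> links r" using e ps(3) by blast
    then have "x \<in> set r" using links_subset_set e(2) by blast
    moreover have "distinct (concat ps)" using ps(1) assms(1) by simp
    ultimately have "q = r" using disjoint_runs q(1) r(1) e(3) by metis
    then show ?thesis using r by simp
  qed
  have sub: "adjacency (links q) \<subseteq> adjacency F" using ps q by (auto simp: adjacency_def)
  have "u \<in> set q" if "(v, u) \<in> (adjacency F)\<^sup>*" for u
    using that
  proof induction
    case (step y z)
    then have "{y, z} \<in> links q" using within[of "{y, z}" y] by (auto simp: adjacency_def)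
    then show ?case using links_subset_set by fastforce
  qed (use q in simp)
  moreover have "(v, u) \<in> (adjacency F)\<^sup>*" if "u \<in> set q" for u
    using links_connected[OF q(2) that] rtrancl_mono[OF sub] by blast
  ultimately have C: "{u \<in> set p. (v, u) \<in> (adjacency F)\<^sup>*} = set q" using qp by blast
  have "{e \<in> F. e \<subseteq> set q} = links q"
  proof (intro equalityI subsetI)
    fix e assume e: "e \<in> {e \<in> F. e \<subseteq> set q}"
    then have "e \<noteq> {}" using card_links assms by fastforce
    then show "e \<in> links q" using within e by blast
  qed (use ps q links_subset_set in blast)
  then have "component (set p, F) v = (set q, links q)"
    using C by (simp add: component_def adjacency_def Let_def)
  then show "is_path (component (set p, F) v)"
    unfolding is_path_def using qp by (intro exI[of _ q]) (auto simp: links_altdef)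
qed

text \<open>The paths of the components are concatenated. The induction runs over vertices, so a
  vertex whose component is already listed contributes nothing.\<close>

lemma list_of_linear_forest:
  assumes "linear_forest F"
  shows "\<exists>p. distinct p \<and> set p = verts F \<and> edges F \<subseteq> links p"
proof -
  define R where "R = (adjacency (edges F))\<^sup>*"
  define C where "C v = {u \<in> verts F. (v, u) \<in> R}" for v
  have F: "finite (verts F)" "\<And>e. e \<in> edges F \<Longrightarrow> e \<subseteq> verts F \<and> card e = 2"
    using assms by (auto simp: linear_forest_def simple_graph_def)
  have eqC: "C v = C w" if "u \<in> C v" "u \<in> C w" for u v w
  proof -
    have vu: "(v, u) \<in> R" "(w, u) \<in> R" using that by (auto simp: C_def)
    then have "(u, v) \<in> R" "(u, w) \<in> R"
      using sym_adjacency_rtrancl[of "edges F"] unfolding R_def sym_def by blast+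
    with vu have vw: "(v, w) \<in> R" "(w, v) \<in> R" unfolding R_def by (auto intro: rtrancl_trans)
    have "(v, x) \<in> R \<longleftrightarrow> (w, x) \<in> R" for x
      using vw unfolding R_def by (meson rtrancl_trans)
    then show ?thesis unfolding C_def by simp
  qed
  have path: "\<exists>q. distinct q \<and> set q = C v \<and> links q = {e \<in> edges F. e \<subseteq> C v}" if "v \<in> verts F" for v
  proof -
    have "component F v = (C v, {e \<in> edges F. e \<subseteq> C v})"
      by (simp add: component_def C_def R_def adjacency_def Let_def)
    moreover have "is_path (component F v)" using assms that by (simp add: linear_forest_def)
    ultimately show ?thesis unfolding is_path_def by (auto simp: links_altdef)
  qed
  have "\<exists>p. distinct p \<and> set p = \<Union> (C ` W) \<and> (\<forall>v \<in> W. \<forall>e \<in> edges F. e \<subseteq> C v \<longrightarrow> e \<in> links p)"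
    if "finite W" "W \<subseteq> verts F" for W
    using that
  proof (induction W rule: finite_induct)
    case (insert v W)
    then obtain p where p: "distinct p" "set p = \<Union> (C ` W)"
      "\<forall>v \<in> W. \<forall>e \<in> edges F. e \<subseteq> C v \<longrightarrow> e \<in> links p" by auto
    have "v \<in> verts F" using insert.prems by simp
    from path[OF this] obtain q
      where q: "distinct q" "set q = C v" "links q = {e \<in> edges F. e \<subseteq> C v}" by blast
    show ?case
    proof (cases "\<exists>w \<in> W. C w = C v")
      case True
      then show ?thesis using p by (intro exI[of _ p]) auto
    next
      case False
      have "x \<notin> set p" if "x \<in> C v" for x
        using that False eqC[of x v] unfolding p(2) by blast
      then have "distinct (q @ p)" "set (q @ p) = \<Union> (C ` insert v W)"
        using p(1,2) q(1,2) by auto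
      moreover have "e \<in> links (q @ p)" if "w \<in> insert v W" "e \<in> edges F" "e \<subseteq> C w" for w e
        using that p(3) q(3) links_append_subset[of q p] by blast
      ultimately show ?thesis by blast
    qed
  qed simp
  from this[OF F(1) subset_refl] obtain p where p: "distinct p" "set p = \<Union> (C ` verts F)"
    "\<forall>v \<in> verts F. \<forall>e \<in> edges F. e \<subseteq> C v \<longrightarrow> e \<in> links p" by blast
  have self: "v \<in> C v" if "v \<in> verts F" for v using that by (auto simp: C_def R_def)
  have "set p = verts F" using p(2) self by (auto simp: C_def)
  moreover have "e \<in> links p" if e: "e \<in> edges F" for e
  proof -
    obtain x y where xy: "e = {x, y}" using F(2)[OF e] by (auto simp: card_2_iff)
    then have "x \<in> verts F" "y \<in> verts F" using F(2)[OF e] by auto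
    moreover have "(x, y) \<in> R" using e xy by (auto simp: R_def adjacency_def)
    ultimately have "e \<subseteq> C x" using xy self by (auto simp: C_def)
    then show ?thesis using p(3) e \<open>x \<in> verts F\<close> by blast
  qed
  ultimately show ?thesis using p(1) by blast
qed

lemma card_edges_isomorphic:
  assumes "simple_graph G" "simple_graph H" "bij_betw f (verts G) (verts H)"
    "\<forall>u \<in> verts G. \<forall>v \<in> verts G. {u, v} \<in> edges G \<longleftrightarrow> {f u, f v} \<in> edges H"
  shows "edges H = (\<lambda>e. f ` e) ` edges G" "card (edges H) = card (edges G)"
proof -
  show eq: "edges H = (\<lambda>e. f ` e) ` edges G"
  proof (intro equalityI subsetI)
    fix e assume e: "e \<in> edges H"
    then have "card e = 2" "e \<subseteq> verts H" using assms(2) by (auto simp: simple_graph_def)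
    then obtain x y where xy: "e = {x, y}" "x \<in> verts H" "y \<in> verts H" by (auto simp: card_2_iff)
    then have "x \<in> f ` verts G" "y \<in> f ` verts G" using assms(3) by (simp_all add: bij_betw_def)
    then obtain u v where uv: "u \<in> verts G" "v \<in> verts G" "e = {f u, f v}"
      using xy(1) by blast
    then have "{u, v} \<in> edges G" using assms(4) e by blast
    then have "f ` {u, v} \<in> (\<lambda>e. f ` e) ` edges G" by (rule imageI)
    then show "e \<in> (\<lambda>e. f ` e) ` edges G" using uv(3) by simp
  next
    fix e assume "e \<in> (\<lambda>e. f ` e) ` edges G"
    then obtain d where d: "d \<in> edges G" "e = f ` d" by auto
    then have "card d = 2" "d \<subseteq> verts G" using assms(1) by (auto simp: simple_graph_def)
    then show "e \<in> edges H" using d assms(4) by (auto simp: card_2_iff)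
  qed
  have "inj_on (\<lambda>e. f ` e) (edges G)"
    using assms(1,3) by (auto simp: inj_on_def bij_betw_def simple_graph_def inj_on_image_eq_iff)
  then show "card (edges H) = card (edges G)" using eq card_image by metis
qed

lemma isomorphic_sym:
  assumes "isomorphic G H" shows "isomorphic H G"
proof -
  obtain f where f: "bij_betw f (verts G) (verts H)"
    "\<forall>u \<in> verts G. \<forall>v \<in> verts G. {u, v} \<in> edges G \<longleftrightarrow> {f u, f v} \<in> edges H"
    using assms by (auto simp: isomorphic_def)
  define g where "g = inv_into (verts G) f"
  have g: "bij_betw g (verts H) (verts G)" using f(1) by (simp add: g_def bij_betw_inv_into)
  have "{u, v} \<in> edges H \<longleftrightarrow> {g u, g v} \<in> edges G" if "u \<in> verts H" "v \<in> verts H" for u v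
  proof -
    have "f (g u) = u" "f (g v) = v"
      using that f(1) by (simp_all add: g_def bij_betw_inv_into_right)
    moreover have "g u \<in> verts G" "g v \<in> verts G" using that g by (simp_all add: bij_betw_apply)
    ultimately show ?thesis using f(2) by force
  qed
  with g show ?thesis unfolding isomorphic_def by blast
qed

text \<open>The forbidden forests have n vertices, as many as \<open>G\<close>, so a copy in
  \<open>G\<close> is spanning and the arrangement of the forest carries over to one of all vertices
  of \<open>G\<close>. Conversely, any k links of an arrangement form a spanning linear
  forest.\<close>

lemma family_free_linear_forests_iff:
  fixes G :: "nat graph"
  assumes G: "simple_graph G" "card (verts G) = n"
  shows "family_free (linear_forests n k) G \<longleftrightarrow> few_links (verts G) (edges G) k"
proof
  assume free: "family_free (linear_forests n k) G"
  show "few_links (verts G) (edges G) k"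
    unfolding few_links_def
  proof (intro allI impI, rule ccontr)
    fix p assume p: "distinct p" "set p = verts G" "\<not> weight (edges G) p < k"
    then have "k \<le> card (links p \<inter> edges G)" by (simp add: weight_eq_card)
    then obtain F where F: "F \<subseteq> links p \<inter> edges G" "card F = k"
      by (rule obtain_subset_with_card_n)
    have lf: "linear_forest (verts G, F)" using linear_forest_of_list[OF p(1)] F p by auto
    then have "(verts G, F) \<in> linear_forests n k" using F G by (simp add: linear_forests_def)
    moreover have "subgraph (verts G, F) G"
      using lf F by (auto simp: subgraph_def linear_forest_def)
    moreover have "isomorphic (verts G, F) (verts G, F)"
      unfolding isomorphic_def by (intro exI[of _ id]) auto
    ultimately show False using free by (auto simp: family_free_def)
  qed
next
  assume few: "few_links (verts G) (edges G) k"
  show "family_free (linear_forests n k) G"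
    unfolding family_free_def
  proof (intro allI impI notI)
    fix H assume H: "subgraph H G" and "\<exists>F \<in> linear_forests n k. isomorphic H F"
    then obtain F where F: "F \<in> linear_forests n k" "isomorphic F H" using isomorphic_sym by blast
    then obtain f where f: "bij_betw f (verts F) (verts H)"
      "\<forall>u \<in> verts F. \<forall>v \<in> verts F. {u, v} \<in> edges F \<longleftrightarrow> {f u, f v} \<in> edges H"
      by (auto simp: isomorphic_def)
    have lf: "linear_forest F" "card (verts F) = n" "card (edges F) = k"
      using F by (auto simp: linear_forests_def)
    then obtain p where p: "distinct p" "set p = verts F" "edges F \<subseteq> links p"
      using list_of_linear_forest by blast
    have "simple_graph F" "simple_graph H" using lf H by (auto simp: linear_forest_def subgraph_def)
    note E = card_edges_isomorphic[OF this f]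
    have "verts H = verts G"
      using G H f lf bij_betw_same_card[OF f(1)]
      by (intro card_subset_eq) (auto simp: subgraph_def simple_graph_def)
    then have q: "distinct (map f p)" "set (map f p) = verts G"
      using f(1) p by (auto simp: bij_betw_def distinct_map)
    have "edges H \<subseteq> links (map f p) \<inter> edges G"
      using E(1) p(3) H by (auto simp: links_map subgraph_def)
    then have "card (edges H) \<le> card (links (map f p) \<inter> edges G)" by (intro card_mono) auto
    then have "k \<le> weight (edges G) (map f p)"
      using E(2) lf(3) unfolding weight_eq_card[OF q(1)] by simp
    then show False using few q by (auto simp: few_links_def)
  qed
qed

section \<open>Copies as pairs of a clique and leaves\<close>

definition star_graph :: "'a set \<times> 'a set \<Rightarrow> 'a graph" where
  "star_graph = (\<lambda>(S, T). (S \<union> T, {{x, y} | x y. x \<in> S \<and> y \<in> S \<union> T \<and> x \<noteq> y}))"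

lemma verts_star_graph [simp]: "verts (star_graph (S, T)) = S \<union> T"
  by (simp add: star_graph_def)

lemma edge_star_graph_iff [simp]:
  "{u, v} \<in> edges (star_graph (S, T)) \<longleftrightarrow>
    u \<noteq> v \<and> u \<in> S \<union> T \<and> v \<in> S \<union> T \<and> (u \<in> S \<or> v \<in> S)"
  by (auto simp: star_graph_def doubleton_eq_iff)

lemma simple_graph_star_graph: "finite S \<Longrightarrow> finite T \<Longrightarrow> simple_graph (star_graph (S, T))"
  by (auto simp: simple_graph_def star_graph_def)

lemma K_star_eq_star_graph: "K_star s t = star_graph ({..<s}, {s..<s + t})"
proof -
  have "{{i, j} | i j. i < s \<and> s \<le> j \<and> j < s + t} \<union> {{i, j} | i j. i < s \<and> j < s \<and> i \<noteq> j} =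
    {{x, y} | x y. x \<in> {..<s} \<and> y \<in> {..<s} \<union> {s..<s + t} \<and> x \<noteq> y}" (is "?A \<union> ?B = ?C")
  proof (intro equalityI subsetI)
    fix e assume "e \<in> ?C"
    then obtain x y where "e = {x, y}" "x < s" "y \<in> {..<s} \<union> {s..<s + t}" "x \<noteq> y" by blast
    then show "e \<in> ?A \<union> ?B" by (cases "y < s") auto
  next
    fix e assume "e \<in> ?A \<union> ?B"
    then obtain i j where "e = {i, j}" "i < s" "i \<noteq> j" "j \<in> {..<s} \<union> {s..<s + t}" by force
    then show "e \<in> ?C" by blast
  qed
  moreover have "{..<s + t} = {..<s} \<union> {s..<s + t}" by auto
  ultimately show ?thesis by (simp add: K_star_def star_graph_def)
qed

lemma simple_graph_eqI:
  assumes "simple_graph G" "simple_graph H" "verts G = verts H"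
    "\<And>u v. u \<in> verts G \<Longrightarrow> v \<in> verts G \<Longrightarrow> {u, v} \<in> edges G \<longleftrightarrow> {u, v} \<in> edges H"
  shows "G = H"
proof -
  have sub: "edges A \<subseteq> edges B"
    if "simple_graph A" and ed: "\<And>u v. u \<in> verts A \<Longrightarrow> v \<in> verts A \<Longrightarrow> {u, v} \<in> edges A \<Longrightarrow> {u, v} \<in> edges B"
    for A B :: "'a graph"
  proof
    fix e assume e: "e \<in> edges A"
    then have "card e = 2" "e \<subseteq> verts A" using that by (auto simp: simple_graph_def)
    then show "e \<in> edges B" using e ed by (auto simp: card_2_iff)
  qed
  have "edges G = edges H" using assms by (intro equalityI sub) auto
  then show ?thesis using assms(3) by (simp add: prod_eq_iff)
qed

text \<open>Two leaves are needed to tell the clique from the leaves: \<open>K_star s 1\<close> is a clique.\<close>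

lemma inj_on_star_graph:
  assumes "2 \<le> t" shows "inj_on star_graph (stars V E s t)"
proof -
  \<comment> \<open>The clique is recovered as the set of vertices adjacent to all others: a leaf is
    not adjacent to a second leaf.\<close>
  have center: "S = {u \<in> verts K. \<forall>v \<in> verts K. v \<noteq> u \<longrightarrow> {u, v} \<in> edges K}"
    if "(S, T) \<in> stars V E s t" "K = star_graph (S, T)" for S T K
  proof -
    have ST: "S \<inter> T = {}" "card T = t" using that by (auto simp: stars_def)
    have "\<exists>w \<in> T. w \<noteq> u" if "u \<in> T" for u
      using ST(2) assms that by (metis One_nat_def card_1_singleton_iff is_singletonI' 
          is_singleton_altdef not_less_eq_eq numeral_2_eq_2 order_refl empty_iff)
    then show ?thesis using ST(1) that(2) by auto
  qed
  show ?thesis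
  proof (rule inj_onI)
    fix X Y assume X: "X \<in> stars V E s t" and Y: "Y \<in> stars V E s t"
      and eq: "star_graph X = star_graph Y"
    obtain S T S' T' where ST: "X = (S, T)" "Y = (S', T')" by (cases X; cases Y) auto
    have "S = {u \<in> verts (star_graph X).
        \<forall>v \<in> verts (star_graph X). v \<noteq> u \<longrightarrow> {u, v} \<in> edges (star_graph X)}"
      using X unfolding ST(1) by (rule center) (rule refl)
    also have "\<dots> = S'"
      unfolding eq using Y unfolding ST(2) by (rule center[symmetric]) (rule refl)
    finally have "S = S'" .
    moreover have "S \<union> T = S' \<union> T'"
      using arg_cong[OF eq, of verts] unfolding ST verts_star_graph .
    ultimately show "X = Y" using X Y ST by (auto simp: stars_def)
  qed
qed

lemma isomorphic_star_graph:
  assumes "finite S" "finite T" "S \<inter> T = {}" "card S = s" "card T = t"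
  shows "isomorphic (star_graph (S, T)) (K_star s t)"
proof -
  obtain f g where f: "bij_betw f S {..<s}" and g: "bij_betw g T {s..<s + t}"
    using assms finite_same_card_bij[of S "{..<s}"] finite_same_card_bij[of T "{s..<s + t}"]
    by auto
  define h where "h x = (if x \<in> S then f x else g x)" for x
  have hS: "bij_betw h S {..<s}" using f by (subst bij_betw_cong[of _ _ f]) (auto simp: h_def)
  have hT: "bij_betw h T {s..<s + t}"
    using g assms(3) by (subst bij_betw_cong[of _ _ g]) (auto simp: h_def)
  have h: "bij_betw h (S \<union> T) ({..<s} \<union> {s..<s + t})"
    using hS hT by (rule bij_betw_combine) auto
  have "x \<in> S \<longleftrightarrow> h x < s" if "x \<in> S \<union> T" for x
    using that bij_betw_apply[OF hS, of x] bij_betw_apply[OF hT, of x] by (cases "x \<in> S") auto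
  moreover have "h x = h y \<longleftrightarrow> x = y" if "x \<in> S \<union> T" "y \<in> S \<union> T" for x y
    using that h by (meson bij_betw_def inj_on_eq_iff)
  moreover have "h x \<in> {..<s} \<union> {s..<s + t}" if "x \<in> S \<union> T" for x
    using that h by (rule bij_betw_apply[rotated])
  ultimately have "\<forall>u \<in> S \<union> T. \<forall>v \<in> S \<union> T. {u, v} \<in> edges (star_graph (S, T)) \<longleftrightarrow>
      {h u, h v} \<in> edges (star_graph ({..<s}, {s..<s + t}))"
    unfolding edge_star_graph_iff by (metis lessThan_iff)
  then show ?thesis
    using h unfolding isomorphic_def K_star_eq_star_graph verts_star_graph by blast
qed

lemma card_copies_K_star:
  assumes G: "simple_graph G" and t: "2 \<le> t"
  shows "card (copies (K_star s t) G) = card (stars (verts G) (edges G) s t)"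
proof -
  have "star_graph ` stars (verts G) (edges G) s t = copies (K_star s t) G"
  proof (intro equalityI subsetI)
    fix H assume "H \<in> star_graph ` stars (verts G) (edges G) s t"
    then obtain S T where H: "H = star_graph (S, T)" and ST: "S \<subseteq> verts G" "T \<subseteq> verts G - S"
      "card S = s" "card T = t" "\<forall>x \<in> S. \<forall>y \<in> S \<union> T. x \<noteq> y \<longrightarrow> {x, y} \<in> edges G"
      by (auto simp: stars_def)
    have fin: "finite S" "finite T"
      using G ST by (auto simp: simple_graph_def intro: finite_subset)
    have "edges H \<subseteq> edges G" using ST(5) by (auto simp: H star_graph_def)
    then have "subgraph H G"
      using simple_graph_star_graph[OF fin] ST(1,2) by (auto simp: subgraph_def H)
    moreover have "isomorphic H (K_star s t)"
      unfolding H using fin ST by (intro isomorphic_star_graph) auto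
    ultimately show "H \<in> copies (K_star s t) G" by (simp add: copies_def)
  next
    fix H assume "H \<in> copies (K_star s t) G"
    then obtain f where H: "subgraph H G" and f: "bij_betw f (verts H) ({..<s} \<union> {s..<s + t})"
      and ed: "\<And>u v. u \<in> verts H \<Longrightarrow> v \<in> verts H \<Longrightarrow>
        {u, v} \<in> edges H \<longleftrightarrow> {f u, f v} \<in> edges (star_graph ({..<s}, {s..<s + t}))"
      unfolding copies_def isomorphic_def K_star_eq_star_graph verts_star_graph by blast
    have simple: "simple_graph H" "finite (verts H)"
      using H by (auto simp: subgraph_def simple_graph_def)
    define S T where "S = {u \<in> verts H. f u < s}" and "T = {u \<in> verts H. s \<le> f u}"
    have V: "verts H = S \<union> T" by (auto simp: S_def T_def)
    have img: "f ` S = {..<s}" "f ` T = {s..<s + t}"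
      using f by (auto simp: bij_betw_def S_def T_def image_iff set_eq_iff) (metis le_add1 less_le_trans linorder_not_le)+
    have inj: "inj_on f (verts H)" using f by (simp add: bij_betw_def)
    have card: "card S = s" "card T = t"
      using card_image[of f S] card_image[of f T] inj img V
      by (auto intro: inj_on_subset)
    have fV: "f u < s + t" if "u \<in> verts H" for u using bij_betw_apply[OF f that] by auto
    have edH: "{u, v} \<in> edges H \<longleftrightarrow> u \<noteq> v \<and> (u \<in> S \<or> v \<in> S)"
      if "u \<in> verts H" "v \<in> verts H" for u v
      using that fV[OF that(1)] fV[OF that(2)] inj unfolding ed[OF that] edge_star_graph_iff
      by (auto simp: S_def inj_on_eq_iff)
    have "H = star_graph (S, T)"
    proof (rule simple_graph_eqI)
      show "simple_graph (star_graph (S, T))"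
        using simple V by (intro simple_graph_star_graph) auto
      show "{u, v} \<in> edges H \<longleftrightarrow> {u, v} \<in> edges (star_graph (S, T))"
        if "u \<in> verts H" "v \<in> verts H" for u v
        using that edH[OF that] V by auto
    qed (use simple V in auto)
    moreover have "(S, T) \<in> stars (verts G) (edges G) s t"
    proof -
      have "{x, y} \<in> edges G" if "x \<in> S" "y \<in> S \<union> T" "x \<noteq> y" for x y
        using that edH[of x y] H V by (auto simp: subgraph_def)
      moreover have "S \<inter> T = {}" by (auto simp: S_def T_def)
      ultimately show ?thesis using H V card by (auto simp: stars_def subgraph_def)
    qed
    ultimately show "H \<in> star_graph ` stars (verts G) (edges G) s t" by blast
  qed
  then show ?thesis using card_image[OF inj_on_star_graph[OF t]] by metis
qed

section \<open>Extremal numbers\<close>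

lemma few_links_closure:
  fixes V :: "nat set"
  assumes "finite V" "few_links V E k" "\<And>e. e \<in> E \<Longrightarrow> e \<subseteq> V \<and> card e = 2"
  shows "\<exists>E'. E \<subseteq> E' \<and> few_links V E' k \<and> (\<forall>e \<in> E'. e \<subseteq> V \<and> card e = 2) \<and>
    (\<forall>u \<in> V. \<forall>v \<in> V. u \<noteq> v \<longrightarrow>
      k \<le> card {x \<in> V. {x, u} \<in> E'} + card {x \<in> V. {x, v} \<in> E'} \<longrightarrow> {u, v} \<in> E')"
proof -
  \<comment> \<open>A maximal admissible edge set takes the place of an iterated closure: by
    \<open>few_links_insert\<close>, a missing pair of large degree sum could still be
    added.\<close>
  define \<E> where "\<E> = {D. few_links V D k \<and> (\<forall>e \<in> D. e \<subseteq> V \<and> card e = 2)}"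
  have fin: "finite \<E>"
    by (rule finite_subset[of _ "Pow (Pow V)"]) (use assms(1) in \<open>auto simp: \<E>_def\<close>)
  have E: "E \<in> \<E>" using assms by (auto simp: \<E>_def)
  from finite_has_maximal2[OF fin E] obtain D
    where D: "D \<in> \<E>" "E \<subseteq> D" "\<forall>D' \<in> \<E>. D \<subseteq> D' \<longrightarrow> D = D'" by auto
  have few: "few_links V D k" and D2: "\<forall>e \<in> D. e \<subseteq> V \<and> card e = 2"
    using D(1) by (simp_all add: \<E>_def)
  have "{u, v} \<in> D" if uv: "u \<in> V" "v \<in> V" "u \<noteq> v"
    "k \<le> card {x \<in> V. {x, u} \<in> D} + card {x \<in> V. {x, v} \<in> D}" for u v
  proof (rule ccontr)
    assume new: "{u, v} \<notin> D"
    have "few_links V (insert {u, v} D) k"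
      by (rule few_links_insert[OF assms(1) few _ _ new uv(4)]) (use D2 in auto)
    then have "insert {u, v} D \<in> \<E>" using D2 uv by (simp add: \<E>_def)
    then show False using D(3) new by blast
  qed
  with few D2 D(2) show ?thesis by blast
qed

lemma card_stars_few_links:
  fixes V :: "nat set"
  assumes V: "finite V" "card V = n" "k \<le> n" and k: "1 \<le> k" and st: "1 \<le> s" "1 \<le> t"
    and few0: "few_links V E k" and E0: "\<And>e. e \<in> E \<Longrightarrow> e \<subseteq> V \<and> card e = 2"
  shows "\<exists>h. k - (k - 1) div 2 \<le> h \<and> h \<le> k \<and>
    card (stars V E s t) \<le> star_bound n s t (k - h) h"
proof -
  define a where "a = (k - 1) div 2"
  have a: "2 * a < k" "k \<le> 2 * a + 2" using k by (auto simp: a_def)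
  from few_links_closure[OF V(1) few0 E0] obtain D
    where D: "E \<subseteq> D" "few_links V D k" "\<forall>e \<in> D. e \<subseteq> V \<and> card e = 2"
    and closed: "\<forall>u \<in> V. \<forall>v \<in> V. u \<noteq> v \<longrightarrow>
      k \<le> card {x \<in> V. {x, u} \<in> D} + card {x \<in> V. {x, v} \<in> D} \<longrightarrow> {u, v} \<in> D"
    by auto
  define deg where "deg U v = card {u \<in> U. u \<noteq> v \<and> {u, v} \<in> D}" for U v
  have deg_mono: "deg U v \<le> deg U' v" if "U \<subseteq> U'" "U' \<subseteq> V" for U U' v
    unfolding deg_def using that V(1) by (intro card_mono) (auto intro: finite_subset)
  have deg_V: "card {u \<in> V. {u, v} \<in> D} = deg V v" for v
  proof -
    have "{v, v} \<notin> D" using D(3) by fastforce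
    then show ?thesis unfolding deg_def by (intro arg_cong[of _ _ card]) auto
  qed
  have bound: "card (stars V E s t) \<le> star_bound n s t d h"
    if "d \<le> h" "h \<le> n" "\<And>U. U \<subseteq> V \<Longrightarrow> h < card U \<Longrightarrow> \<exists>v \<in> U. deg U v \<le> d" for d h
  proof -
    have "card (stars V E s t) \<le> card (stars V D s t)"
      using stars_mono[OF D(1)] V(1) by (intro card_mono) auto
    also have "\<dots> \<le> star_bound n s t d h"
      using card_stars_degenerate[of V d h s t D] that V st by (auto simp: deg_def)
    finally show ?thesis .
  qed
  \<comment> \<open>A union of sets of minimum degree above \<open>a\<close> has this property
    again, so \<open>H\<close> is what repeated removal leaves, whatever the order.\<close>
  define H where "H = \<Union> {U. U \<subseteq> V \<and> (\<forall>v \<in> U. a < deg U v)}"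
  have HV: "H \<subseteq> V" by (auto simp: H_def)
  have H_max: "U \<subseteq> H" if "U \<subseteq> V" "\<forall>v \<in> U. a < deg U v" for U
    using that unfolding H_def by blast
  have H_deg: "a < deg H v" if vH: "v \<in> H" for v
  proof -
    obtain U where U: "v \<in> U" "U \<subseteq> V" "\<forall>v \<in> U. a < deg U v"
      using vH unfolding H_def by blast
    then have "a < deg U v" by blast
    also have "\<dots> \<le> deg H v" by (rule deg_mono[OF H_max[OF U(2,3)] HV])
    finally show ?thesis .
  qed
  show ?thesis
  proof (cases "H = {}")
    case True
    have "\<exists>v \<in> U. deg U v \<le> a" if "U \<subseteq> V" "k - a < card U" for U
    proof (rule ccontr)
      assume "\<not> ?thesis"
      then have "U \<subseteq> H" using that(1) by (intro H_max) auto
      then show False using True that(2) by simp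
    qed
    then have "card (stars V E s t) \<le> star_bound n s t a (k - a)"
      using a V by (intro bound) auto
    moreover have "k - (k - a) = a" using a by simp
    ultimately show ?thesis unfolding a_def by (intro exI[of _ "k - (k - 1) div 2"]) simp
  next
    case False
    define h where "h = card H"
    have finH: "finite H" using HV V(1) finite_subset by blast
    have clique: "{x, y} \<in> D" if "x \<in> H" "y \<in> H" "x \<noteq> y" for x y
    proof (rule closed[rule_format])
      have "a < deg V x" "a < deg V y"
        using H_deg that deg_mono[OF HV subset_refl] less_le_trans by blast+
      then show "k \<le> card {u \<in> V. {u, x} \<in> D} + card {u \<in> V. {u, y} \<in> D}"
        unfolding deg_V using a by linarith
    qed (use that HV in auto)
    have degH: "deg H v = h - 1" if "v \<in> H" for v
    proof -
      have "{u \<in> H. u \<noteq> v \<and> {u, v} \<in> D} = H - {v}" using that clique by auto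
      then show ?thesis using that by (simp add: deg_def h_def)
    qed
    have hk: "h \<le> k" unfolding h_def using few_links_clique[OF V(1) D(2) HV False] clique by blast
    \<comment> \<open>A vertex of the clique has h - 1 neighbours in it, and this exceeds
      \<open>a\<close>.\<close>
    have ah: "a + 2 \<le> h" using False H_deg degH by fastforce
    have outside: "deg V v \<le> k - h" if v: "v \<in> V" "v \<notin> H" for v
    proof (rule ccontr)
      assume contr: "\<not> ?thesis"
      \<comment> \<open>The degrees are at least h - 1 and at least k - h + 1, so closedness
        applies. Then \<open>v\<close> has h > a neighbours in \<open>H\<close>, and
        \<open>insert v H\<close> contradicts the maximality of \<open>H\<close>.\<close>
      have adj: "{x, v} \<in> D" if "x \<in> H" for x
      proof (rule closed[rule_format])
        have "h - 1 \<le> deg V x" using deg_mono[OF HV subset_refl, of x] degH[OF that] by simp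
        then show "k \<le> card {u \<in> V. {u, x} \<in> D} + card {u \<in> V. {u, v} \<in> D}"
          unfolding deg_V using contr ah by linarith
      qed (use that v HV in auto)
      have "{u \<in> insert v H. u \<noteq> v \<and> {u, v} \<in> D} = H" using adj v by auto
      then have "deg (insert v H) v = h" by (simp add: deg_def h_def)
      moreover have "a < deg (insert v H) x" if "x \<in> H" for x
        using H_deg[OF that] deg_mono[of H "insert v H" x] v HV by fastforce
      ultimately have "insert v H \<subseteq> H" using ah v HV by (intro H_max) auto
      then show False using v by simp
    qed
    have "\<exists>v \<in> U. deg U v \<le> k - h" if U: "U \<subseteq> V" "h < card U" for U
    proof -
      have "\<not> U \<subseteq> H" using U(2) card_mono[OF finH, of U] by (auto simp: h_def)
      then obtain v where v: "v \<in> U" "v \<notin> H" by blast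
      have "deg U v \<le> deg V v" by (rule deg_mono[OF U(1) subset_refl])
      also have "\<dots> \<le> k - h" using v U(1) by (intro outside) auto
      finally show ?thesis using v(1) by blast
    qed
    \<comment> \<open>From k <= 2a + 2 and a + 2 <= h follow k - a <= a + 2 <= h and k - h <=
      a.\<close>
    moreover have "k - h \<le> h" "k - (k - 1) div 2 \<le> h" using a ah by (auto simp: a_def)
    ultimately show ?thesis using bound[of "k - h" h] hk V(3) by (intro exI[of _ h]) auto
  qed
qed

section \<open>Lower bound: the extremal graphs\<close>

definition core_edges :: "nat \<Rightarrow> nat \<Rightarrow> nat \<Rightarrow> nat set set" where
  "core_edges n a b = {{x, y} | x y. x \<noteq> y \<and> x < n \<and> y < n \<and> (x < a \<or> x < b \<and> y < b)}"

lemma core_edges_iff: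
  "{x, y} \<in> core_edges n a b \<longleftrightarrow>
    x \<noteq> y \<and> x < n \<and> y < n \<and> (x < a \<or> y < a \<or> x < b \<and> y < b)"
  by (auto simp: core_edges_def doubleton_eq_iff)

lemma simple_core_graph: "simple_graph ({..<n}, core_edges n a b)"
  by (auto simp: simple_graph_def core_edges_def)

text \<open>The links inside \<open>A\<close> join its entries into runs, each with one link fewer
  than entries. Truncated subtraction covers the case that no entry lies in
  \<open>A\<close>.\<close>

lemma weight_within_le:
  assumes "finite A" "distinct p"
  shows "weight {e. e \<subseteq> A} p \<le> card (set p \<inter> A) - 1"
  using assms(2)
proof (induction p rule: links.induct)
  case (1 x y zs)
  have "0 < card (set (y # zs) \<inter> A)" if "y \<in> A"
    using that assms(1) by (auto simp: card_gt_0_iff)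
  then show ?case using 1 assms(1) by (auto simp: Int_insert_left split: if_splits)
qed auto

text \<open>Every entry lies in at most two links, the head in at most one. The extra summand for
  the head pays for the link to a new head in the induction.\<close>

lemma weight_meeting_le:
  assumes "finite A" "distinct p" "p \<noteq> []"
  shows "weight {e. e \<inter> A \<noteq> {}} p + of_bool (hd p \<in> A) \<le> 2 * card (set p \<inter> A)"
  using assms(2,3)
proof (induction p rule: links.induct)
  case (1 x y zs)
  then show ?case using assms(1) by (auto simp: Int_insert_left split: if_splits)
qed auto

text \<open>Every edge meets the first a vertices or lies inside the next b - a. The former account
  for at most 2a links, the latter for at most b - a - 1.\<close>

lemma few_links_core:
  assumes "a < b" "b \<le> n"
  shows "few_links {..<n} (core_edges n a b) (a + b)"
  unfolding few_links_def
proof (intro allI impI)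
  fix p assume p: "distinct p" "set p = {..<n}"
  have "0 \<in> set p" unfolding p(2) using assms by simp
  then have "p \<noteq> []" by auto
  have "core_edges n a b \<subseteq> {e. e \<inter> {..<a} \<noteq> {}} \<union> {e. e \<subseteq> {a..<b}}"
  proof
    fix e assume "e \<in> core_edges n a b"
    then obtain x y where e: "e = {x, y}" "x < a \<or> x < b \<and> y < b"
      by (auto simp: core_edges_def)
    show "e \<in> {e. e \<inter> {..<a} \<noteq> {}} \<union> {e. e \<subseteq> {a..<b}}"
      by (cases "x < a"; cases "y < a") (use e in auto)
  qed
  from order.trans[OF weight_mono[OF this] weight_Un_le] have "weight (core_edges n a b) p
      \<le> weight {e. e \<inter> {..<a} \<noteq> {}} p + weight {e. e \<subseteq> {a..<b}} p" .
  also have "\<dots> \<le> 2 * card (set p \<inter> {..<a}) + (card (set p \<inter> {a..<b}) - 1)"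
  proof (rule add_mono)
    show "weight {e. e \<inter> {..<a} \<noteq> {}} p \<le> 2 * card (set p \<inter> {..<a})"
      by (rule order.trans[OF le_add1 weight_meeting_le]) (use p(1) \<open>p \<noteq> []\<close> in simp_all)
    show "weight {e. e \<subseteq> {a..<b}} p \<le> card (set p \<inter> {a..<b}) - 1"
      using p(1) by (intro weight_within_le) simp_all
  qed
  also have "card (set p \<inter> {..<a}) = a"
  proof -
    have "set p \<inter> {..<a} = {..<a}" unfolding p(2) using assms by auto
    then show ?thesis by simp
  qed
  also have "card (set p \<inter> {a..<b}) = b - a"
  proof -
    have "set p \<inter> {a..<b} = {a..<b}" unfolding p(2) using assms by auto
    then show ?thesis by simp
  qed
  \<comment> \<open>The sum is a + b - 1, where a < b prevents truncation of b - a - 1.\<close>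
  finally show "weight (core_edges n a b) p < a + b" using assms by linarith
qed

text \<open>Three families of stars have the sizes of the three summands. They are disjoint because
  their clique parts lie inside \<open>{..<a}\<close>, not inside \<open>{..<b}\<close>, or inside
  \<open>{..<b}\<close> but not inside \<open>{..<a}\<close>.\<close>

lemma star_bound_le_core:
  assumes ab: "a \<le> b" "b \<le> n" and s: "1 \<le> s"
  shows "star_bound n s t a b \<le> card (stars {..<n} (core_edges n a b) s t)"
proof -
  define P1 where "P1 = (SIGMA S:{S. S \<subseteq> {..<a} \<and> card S = s}. {T. T \<subseteq> {..<n} - S \<and> card T = t})"
  define P2 where "P2 = (\<lambda>(v, S, T). (insert v S, T)) ` ({b..<n} \<times>
    (SIGMA S:{S. S \<subseteq> {..<a} \<and> card S = s - 1}. {T. T \<subseteq> {..<a} - S \<and> card T = t}))"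
  define P3 where "P3 = (SIGMA S:{S. S \<subseteq> {..<b} \<and> card S = s} - {S. S \<subseteq> {..<a} \<and> card S = s}.
    {T. T \<subseteq> {..<b} - S \<and> card T = t})"
  have fin: "finite {S. S \<subseteq> {..<m} \<and> Q S}" for m :: nat and Q
    by (rule finite_subset[of _ "Pow {..<m}"]) auto
  have fin': "finite {T. T \<subseteq> {..<m} - S \<and> Q T}" for m :: nat and S Q
    by (rule finite_subset[of _ "Pow {..<m}"]) auto
  have c1: "card P1 = (a choose s) * ((n - s) choose t)"
    unfolding P1_def using card_disjoint_pairs[of "{..<n}" "{..<a}" s t] ab by simp
  have c2: "card P2 = (n - b) * (a choose (s - 1)) * ((a + 1 - s) choose t)"
  proof -
    have inj: "inj_on (\<lambda>(v, S, T). (insert v S, T)) ({b..<n} \<times>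
      (SIGMA S:{S. S \<subseteq> {..<a} \<and> card S = s - 1}. {T. T \<subseteq> {..<a} - S \<and> card T = t}))"
    proof (rule inj_onI, clarsimp)
      fix v S w S' assume v: "b \<le> v" "b \<le> w" "S \<subseteq> {..<a}" "S' \<subseteq> {..<a}" "insert v S = insert w S'"
      \<comment> \<open>The added vertex is recovered as the only one outside
        \<open>{..<b}\<close>.\<close>
      have "{v} = insert v S - {..<b} \<and> S = insert v S \<inter> {..<b}"
        if "b \<le> v" "S \<subseteq> {..<a}" for v S
        using that ab by auto
      from this[of v S] this[of w S'] v show "v = w \<and> S = S'"
        by (metis singleton_inject)
    qed
    have s1: "a + 1 - s = a - (s - 1)" using s by simp
    show ?thesis
      unfolding P2_def card_image[OF inj] card_cartesian_product s1
        card_disjoint_pairs[OF finite_lessThan subset_refl]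
      by (simp only: card_atLeastLessThan card_lessThan mult.assoc)
  qed
  have c3: "card P3 = ((b choose s) - (a choose s)) * ((b - s) choose t)"
  proof -
    have "card {T. T \<subseteq> {..<b} - S \<and> card T = t} = (b - s) choose t"
      if "S \<in> {S. S \<subseteq> {..<b} \<and> card S = s}" for S
      using that n_subsets[of "{..<b} - S" t] by (auto simp: card_Diff_subset finite_subset)
    then have "card P3 = card ({S. S \<subseteq> {..<b} \<and> card S = s} - {S. S \<subseteq> {..<a} \<and> card S = s})
        * ((b - s) choose t)"
      unfolding P3_def using fin fin' by (subst card_SigmaI) auto
    also have "card ({S. S \<subseteq> {..<b} \<and> card S = s} - {S. S \<subseteq> {..<a} \<and> card S = s}) =
        (b choose s) - (a choose s)"
      using ab n_subsets[of "{..<b}" s] n_subsets[of "{..<a}" s] fin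
      by (subst card_Diff_subset) auto
    finally show ?thesis .
  qed
  have finP: "finite P1" "finite P2" "finite P3"
    unfolding P1_def P2_def P3_def using fin fin' by (auto intro!: finite_SigmaI finite_imageI)
  have P1: "S \<subseteq> {..<a}" if "(S, T) \<in> P1" for S T using that by (auto simp: P1_def)
  have P2: "\<not> S \<subseteq> {..<b}" if "(S, T) \<in> P2" for S T using that by (auto simp: P2_def)
  have P3: "S \<subseteq> {..<b} \<and> \<not> S \<subseteq> {..<a}" if "(S, T) \<in> P3" for S T using that by (auto simp: P3_def)
  have sub: "{..<a} \<subseteq> {..<b}" using ab by simp
  have "X \<notin> P2 \<and> X \<notin> P3" if "X \<in> P1" for X
    using that P1[of "fst X" "snd X"] P2[of "fst X" "snd X"] P3[of "fst X" "snd X"]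
      order.trans[OF _ sub] by (metis prod.collapse)
  moreover have "X \<notin> P3" if "X \<in> P2" for X
    using that P2[of "fst X" "snd X"] P3[of "fst X" "snd X"] by (metis prod.collapse)
  ultimately have disj: "P1 \<inter> P2 = {}" "(P1 \<union> P2) \<inter> P3 = {}" by auto
  have "P1 \<union> P2 \<union> P3 \<subseteq> stars {..<n} (core_edges n a b) s t"
  proof (intro Un_least subsetI)
    fix X assume "X \<in> P1"
    then show "X \<in> stars {..<n} (core_edges n a b) s t"
      using ab by (auto simp: P1_def stars_def core_edges_iff subset_iff)
  next
    fix X assume "X \<in> P2"
    then obtain v S T where X: "X = (insert v S, T)" and v: "b \<le> v" "v < n"
      and ST: "S \<subseteq> {..<a}" "card S = s - 1" "T \<subseteq> {..<a} - S" "card T = t"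
      by (auto simp: P2_def)
    have "v \<notin> S" "finite S" using v ST ab by (auto intro: finite_subset)
    then have "card (insert v S) = s" using ST s by simp
    then show "X \<in> stars {..<n} (core_edges n a b) s t"
      using v ST ab by (auto simp: X stars_def core_edges_iff subset_iff)
  next
    fix X assume "X \<in> P3"
    then show "X \<in> stars {..<n} (core_edges n a b) s t"
      using ab by (auto simp: P3_def stars_def core_edges_iff subset_iff)
  qed
  then have "card (P1 \<union> P2 \<union> P3) \<le> card (stars {..<n} (core_edges n a b) s t)"
    by (intro card_mono) auto
  moreover have "card (P1 \<union> P2 \<union> P3) = star_bound n s t a b"
    using finP disj c1 c2 c3 by (simp add: card_Un_disjoint star_bound_def)
  ultimately show ?thesis by simp
qed

text \<open>For k = 2m + 1 the values are m and m + 1, for k = 2m + 2 they are m and m + 2; in both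
  cases they add up to k.\<close>

lemma floor_ceiling_halves:
  assumes "1 \<le> k"
  shows "nat \<lfloor>(real k - 1) / 2\<rfloor> = (k - 1) div 2"
    "nat \<lceil>(real k + 1) / 2\<rceil> = k - (k - 1) div 2"
proof -
  obtain m where k: "k = 2 * m + 1 \<or> k = 2 * m + 2"
    using assms by (metis add_2_eq_Suc' Suc_eq_plus1 oddE evenE dvd_0_right mult_Suc_right not_one_le_zero old.nat.exhaust)
  then show "nat \<lfloor>(real k - 1) / 2\<rfloor> = (k - 1) div 2"
    "nat \<lceil>(real k + 1) / 2\<rceil> = k - (k - 1) div 2"
    by (auto simp: floor_eq_iff ceiling_eq_iff nat_eq_iff)
qed

theorem theorem1p6:
  fixes s t n k :: nat
  assumes "s \<ge> 1" and "t \<ge> 2" and "k \<ge> 1" and "n \<ge> k + 1"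
  shows "ex n (K_star s t) (linear_forests n k) =
    (let a = nat \<lfloor>(real k - 1) / 2\<rfloor>; b = nat \<lceil>(real k + 1) / 2\<rceil> in
     max ((k choose (s + t)) * ((s + t) choose t))
         ((a choose s) * ((n - s) choose t)
          + (n - b) * (a choose (s - 1)) * ((a + 1 - s) choose t)
          + ((b choose s) - (a choose s)) * ((b - s) choose t)))"
proof -
  define a b where "a = (k - 1) div 2" and "b = k - a"
  have ab: "a < b" "b \<le> n" "a + b = k" "k - b = a" "k \<le> 2 * b" using assms by (auto simp: a_def b_def)
  let ?A = "{card (copies (K_star s t) G) | G :: nat graph.
     simple_graph G \<and> card (verts G) = n \<and> family_free (linear_forests n k) G}"
  have lower: "\<exists>c \<in> ?A. star_bound n s t a' b' \<le> c" if "a' < b'" "b' \<le> n" "a' + b' = k" for a' b'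
  proof
    let ?G = "({..<n}, core_edges n a' b')"
    have "family_free (linear_forests n k) ?G"
      using family_free_linear_forests_iff[OF simple_core_graph, of n a' b' n k]
        few_links_core[OF that(1,2)] that(3) by simp
    then show "card (copies (K_star s t) ?G) \<in> ?A" using simple_core_graph by fastforce
    show "star_bound n s t a' b' \<le> card (copies (K_star s t) ?G)"
      using star_bound_le_core[of a' b' n s t] that assms
      by (simp add: card_copies_K_star[OF simple_core_graph])
  qed
  have upper: "c \<le> max (star_bound n s t 0 k) (star_bound n s t a b)" if c: "c \<in> ?A" for c
  proof -
    obtain G :: "nat graph" where G: "simple_graph G" "card (verts G) = n"
      "family_free (linear_forests n k) G" "c = card (copies (K_star s t) G)"
      using c by blast
    then have "few_links (verts G) (edges G) k" using family_free_linear_forests_iff by blast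
    then obtain h where h: "b \<le> h" "h \<le> k"
      "card (stars (verts G) (edges G) s t) \<le> star_bound n s t (k - h) h"
      using card_stars_few_links[of "verts G" n k s t "edges G"] G assms
      by (auto simp: simple_graph_def a_def b_def)
    have "c = card (stars (verts G) (edges G) s t)"
      using card_copies_K_star G assms by simp
    also note h(3)
    also have "star_bound n s t (k - h) h \<le> max (star_bound n s t 0 k) (star_bound n s t (k - b) b)"
      using ab h assms by (intro star_bound_le_max) auto
    finally show ?thesis using ab by simp
  qed
  have clique: "star_bound n s t 0 k = (k choose (s + t)) * ((s + t) choose t)"
  proof -
    \<comment> \<open>With a = 0 the first summand vanishes because s is positive. In the second,
      \<open>0 choose (s - 1)\<close> leaves only s = 1, and then \<open>0 choose t\<close> is
      0.\<close>
    obtain s' t' where "s = Suc s'" "t = Suc t'"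
      using assms by (metis Suc_le_D One_nat_def Suc_leD numeral_2_eq_2)
    then show ?thesis unfolding choose_mult_choose by (simp add: star_bound_def)
  qed
  have "ex n (K_star s t) (linear_forests n k) = max (star_bound n s t 0 k) (star_bound n s t a b)"
    unfolding ex_def
  proof (rule Max_eqI)
    obtain c where c: "c \<in> ?A" "star_bound n s t 0 k \<le> c"
      using lower[of 0 k] assms by auto
    obtain d where d: "d \<in> ?A" "star_bound n s t a b \<le> d"
      using lower[OF ab(1-3)] by blast
    \<comment> \<open>The graph belonging to the larger of the two values has at least that many
      copies, and by \<open>upper\<close> no more.\<close>
    have "max (star_bound n s t 0 k) (star_bound n s t a b) = c \<or>
        max (star_bound n s t 0 k) (star_bound n s t a b) = d" (is "?M = _ \<or> _")
      using upper[OF c(1)] c(2) upper[OF d(1)] d(2) by linarith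
    then show "?M \<in> ?A"
    proof
      assume "?M = c"
      show ?thesis unfolding \<open>?M = c\<close> by (rule c(1))
    next
      assume "?M = d"
      show ?thesis unfolding \<open>?M = d\<close> by (rule d(1))
    qed
  qed (fact finite_copy_counts, fact upper)
  then show ?thesis
    unfolding Let_def floor_ceiling_halves[OF assms(3)] a_def[symmetric] b_def[symmetric]
      clique[symmetric] star_bound_def[of n s t a b, symmetric] .
qed

end
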